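(* For a prime $p\ge 5$ let $(d_n)_{n\ge 0}$ be the $(p-3)/2$-periodic binary sequence of parities of differences of consecutive quadratic residues modulo $p$ (defined in the context). Let $N(0)$ and $N(1)$ denote the number of $0$s and $1$s in a period of $(d_n)$, respectively, that is, the number of $n$ with $0\le n\le (p-5)/2$ and $d_n=0$, respectively $d_n=1$. Then $$N(0)=\frac{p}{6}+O\left(p^{1/2}(\log p)^2\right)$$ and $$N(1)=\frac{p}{3}+O\left(p^{1/2}(\log p)^2\right).$$
   Context: For a prime $p\ge 5$, let $q_0,q_1,\ldots,q_{(p-3)/2}$ be the (nonzero) quadratic residues modulo $p$, represented as integers in increasing order, $1=q_0<q_1<\cdots<q_{(p-3)/2}\le p-1$. The sequence $(d_n)_{n\ge 0}$ with values in $\{0,1\}$ is defined by $d_n = (q_n+q_{n+1}) \bmod 2$ (sum of integers, reduced modulo $2$) for $n=0,1,\ldots,(p-5)/2$, and $d_{n+(p-3)/2}=d_n$ for all $n\ge 0$. The notation $f=O(g)$ means $|f|\le c g$ for some absolute constant $c>0$ (here independent of $p$). $\log$ is the natural logarithm. *)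

theory Defs
  imports Complex_Main "HOL-Number_Theory.Number_Theory"
begin

definition quad_residues :: "nat \<Rightarrow> nat set" where
  "quad_residues p = {a. 1 \<le> a \<and> a \<le> p - 1 \<and> QuadRes (int p) (int a)}"

text \<open>For an odd prime \<open>p\<close> there are \<open>(p - 1) div 2\<close> quadratic residues, so \<open>nth_qres p n\<close> is
  meaningful for \<open>n \<le> (p - 3) div 2\<close>.\<close>

definition nth_qres :: "nat \<Rightarrow> nat \<Rightarrow> nat" where
  "nth_qres p n = sorted_list_of_set (quad_residues p) ! n"

text \<open>The index is reduced modulo the period \<open>(p - 3) div 2\<close>, which is positive for odd \<open>p \<ge> 5\<close>;
  the two lemmas below are the defining equations of the sequence.\<close>

definition qres_parity :: "nat \<Rightarrow> nat \<Rightarrow> nat" where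
  "qres_parity p n =
     (let m = n mod ((p - 3) div 2) in (nth_qres p m + nth_qres p (m + 1)) mod 2)"

lemma qres_parity_initial:
  assumes "p \<ge> 5" and "n \<le> (p - 5) div 2"
  shows "qres_parity p n = (nth_qres p n + nth_qres p (n + 1)) mod 2"
proof -
  have "n < (p - 3) div 2"
    using assms by linarith
  then show ?thesis
    by (simp add: qres_parity_def)
qed

lemma qres_parity_periodic: "qres_parity p (n + (p - 3) div 2) = qres_parity p n"
  by (simp add: qres_parity_def)

definition num_parity :: "nat \<Rightarrow> nat \<Rightarrow> nat" where
  "num_parity p b = card {n. n \<le> (p - 5) div 2 \<and> qres_parity p n = b}"

end

theory Submission
  imports Defs "Berlekamp_Zassenhaus.Finite_Field"
begin

text \<open>
  Write \<open>g\<close> for the gap between two consecutive quadratic residues; an entry of the sequence is the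
  parity of \<open>g\<close>. The residues behave like the heads in a sequence of fair coin tosses: a gap longer
  than \<open>d\<close> starts at about \<open>p / 2 ^ (d + 1)\<close> places. Since the alternating sum of \<open>(-1) ^ d\<close> over
  \<open>d < g\<close> is 1 for odd \<open>g\<close> and 0 for even \<open>g\<close>, the number of odd gaps is the alternating sum over
  \<open>d\<close> of the numbers of gaps longer than \<open>d\<close>, hence about
  \<open>p/2 - p/4 + p/8 - \<dots> = p/3\<close>. Stopping after \<open>D\<close> terms costs at most the number of
  gaps longer than \<open>D\<close> (\<open>num_parity_1_truncated\<close>), so \<open>D\<close> of size \<open>log p\<close> is enough, and the
  even gaps are the remaining ones among \<open>(p - 3) / 2\<close>.

  For the error term, the indicator function of the pattern ``a residue, then \<open>d\<close> places without a
  residue'' is expanded into products of Legendre symbols of the shifts \<open>x + i\<close>. The empty product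
  gives the main term. The other products are bounded by Weil's theorem: the sum over \<open>x\<close> of the
  Legendre symbol of a product of \<open>k\<close> distinct shifts is \<open>O(k * sqrt p)\<close>
  (\<open>weil_bound_Legendre\<close>). So each count has error \<open>O(d * sqrt p)\<close>, and
  summation over \<open>d \<le> D\<close> produces the square of the logarithm. A bound of
  higher order in \<open>k\<close> would cost further logarithms.

  Weil's bound is proved by Stepanov's method, over a field with \<open>q = 2 * c + 1\<close> elements, \<open>q\<close> prime.
  To bound the number of \<open>x\<close> with \<open>f(x)^c = a\<close>, one constructs a non-zero polynomial
  of the form \<open>f^l\<close> times the sum of \<open>(r\<^sub>j + s\<^sub>j f^c) X^(j q)\<close> that vanishes to order
  \<open>l\<close>, about \<open>sqrt q\<close>, at all these points. At these points \<open>f(x)^c\<close> can be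
  replaced by \<open>a\<close> and \<open>x^q\<close> by \<open>x\<close>, so the vanishing of the derivatives follows from
  linear conditions on the small polynomials \<open>r\<^sub>j, s\<^sub>j\<close> which are few enough to have a non-trivial
  solution. The polynomial so obtained is not zero because \<open>f\<close> is not a constant times a square
  (\<open>no_small_relation_with_power\<close>). Comparing the degree with the number of zeros gives
  \<open>q/2 + O(m * sqrt q)\<close>, \<open>m\<close> being the degree of \<open>f\<close>, as an upper bound for each of
  the two values \<open>a = 1\<close> and \<open>a = -1\<close>; as the two counts add up to nearly \<open>q\<close>, they nearly agree.

  Fields are types here, and a type cannot depend on the variable \<open>p\<close>. The passage from fields to
  all primes therefore goes through one particular prime, a counterexample to Weil's bound if there
  is any; a constant type indexed by it carries the field in which the bound is proved.
\<close>

section \<open>Spaces of polynomials of bounded degree\<close>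

text \<open>
  The condition on the coefficients, rather than on the degree, makes the set a vector space of
  dimension \<open>n\<close> also for \<open>n = 0\<close>.
\<close>
definition polys_below :: "nat \<Rightarrow> 'a::zero poly set" where
  "polys_below n = {u. \<forall>i\<ge>n. coeff u i = 0}"

lemma polys_below_0: "polys_below 0 = {0}"
  by (auto simp: polys_below_def poly_eq_iff)

lemma zero_in_polys_below [simp]: "0 \<in> polys_below n"
  by (simp add: polys_below_def)

lemma polys_below_mono: "u \<in> polys_below n \<Longrightarrow> n \<le> k \<Longrightarrow> u \<in> polys_below k"
  by (auto simp: polys_below_def)

lemma polys_below_add:
  "u \<in> polys_below n \<Longrightarrow> v \<in> polys_below n \<Longrightarrow> u + v \<in> polys_below n"
  by (auto simp: polys_below_def)

lemma polys_below_diff: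
  fixes u :: "'a::ab_group_add poly"
  shows "u \<in> polys_below n \<Longrightarrow> v \<in> polys_below n \<Longrightarrow> u - v \<in> polys_below n"
  by (auto simp: polys_below_def)

lemma polys_below_smult: "u \<in> polys_below n \<Longrightarrow> smult a u \<in> polys_below n"
  by (auto simp: polys_below_def)

lemma polys_below_sum:
  "(\<And>j. j \<in> S \<Longrightarrow> u j \<in> polys_below n) \<Longrightarrow> (\<Sum>j\<in>S. u j) \<in> polys_below n"
  by (auto simp: polys_below_def coeff_sum intro!: sum.neutral)

lemma polys_below_pderiv:
  fixes u :: "'a::idom poly"
  shows "u \<in> polys_below n \<Longrightarrow> pderiv u \<in> polys_below n"
  by (auto simp: polys_below_def coeff_pderiv)

lemma degree_less_if_polys_below: "u \<in> polys_below n \<Longrightarrow> u \<noteq> 0 \<Longrightarrow> degree u < n"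
  by (metis (mono_tags, lifting) leading_coeff_0_iff linorder_le_less_linear
      mem_Collect_eq polys_below_def)

lemma polys_belowI: "degree u < n \<Longrightarrow> u \<in> polys_below n"
  by (auto simp: polys_below_def coeff_eq_0)

lemma polys_below_mult:
  assumes "u \<in> polys_below n" "degree v \<le> m"
  shows "v * u \<in> polys_below (n + m)"
proof (cases "u = 0")
  case False
  then show ?thesis
    using degree_less_if_polys_below[OF assms(1)] assms(2) degree_mult_le[of v u]
    by (intro polys_belowI) linarith
qed simp

lemma polys_below_mult_monom: "u \<in> polys_below n \<Longrightarrow> u * monom a k \<in> polys_below (n + k)"
  using polys_below_mult[of u n "monom a k" k] by (simp add: degree_monom_le mult.commute)

text \<open>
  Peeling off the constant coefficient; this is what lets the cardinality be computed by induction.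
\<close>
lemma polys_below_Suc:
  "polys_below (Suc n) = (\<lambda>(a, u). pCons a u) ` (UNIV \<times> polys_below n)"
proof (intro equalityI subsetI)
  fix u :: "'a poly" assume "u \<in> polys_below (Suc n)"
  moreover obtain a v where "u = pCons a v" by (cases u)
  ultimately show "u \<in> (\<lambda>(a, u). pCons a u) ` (UNIV \<times> polys_below n)"
    by (fastforce simp: polys_below_def coeff_pCons split: nat.splits)
qed (auto simp: polys_below_def coeff_pCons split: nat.splits)

lemma finite_polys_below [simp]: "finite (polys_below n :: 'a::{zero,finite} poly set)"
  by (induction n) (auto simp: polys_below_0 polys_below_Suc)

lemma card_polys_below: "card (polys_below n :: 'a::{zero,finite} poly set) = CARD('a) ^ n"
proof (induction n)
  case (Suc n)
  have "inj_on (\<lambda>(a, u). pCons a u) (UNIV \<times> (polys_below n :: 'a poly set))"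
    by (auto simp: inj_on_def)
  then show ?case
    using Suc by (simp add: polys_below_Suc card_image card_cartesian_product)
qed (simp add: polys_below_0)

section \<open>Derivatives of a product with a high power\<close>

text \<open>
  Each differentiation of \<open>f ^ n * h\<close> costs one factor \<open>f\<close>; the remaining cofactor is a
  polynomial whose degree grows only by the degree of \<open>f\<close> per step. The recursion is the Leibniz rule
  for \<open>f ^ (n - k) * h\<close> after cancelling \<open>f ^ (n - k - 1)\<close>.
\<close>
primrec deriv_cofactor :: "'a::idom poly \<Rightarrow> nat \<Rightarrow> nat \<Rightarrow> 'a poly \<Rightarrow> 'a poly" where
  "deriv_cofactor f n 0 h = h"
| "deriv_cofactor f n (Suc k) h =
     smult (of_nat (n - k)) (pderiv f * deriv_cofactor f n k h) + f * pderiv (deriv_cofactor f n k h)"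

lemma higher_pderiv_power_mult:
  "k \<le> n \<Longrightarrow> (pderiv ^^ k) (f ^ n * h) = f ^ (n - k) * deriv_cofactor f n k h"
proof (induction k)
  case (Suc k)
  then obtain d where d: "n = Suc d + k"
    by (metis add.commute less_eqE add_Suc_right)
  have "(pderiv ^^ Suc k) (f ^ n * h) = pderiv (f ^ Suc d * deriv_cofactor f n k h)"
    using Suc d by simp
  also have "\<dots> = f ^ d * deriv_cofactor f n (Suc k) h"
    by (simp add: pderiv_mult pderiv_power_Suc d algebra_simps del: power_Suc of_nat_Suc)
       (simp add: algebra_simps)
  finally show ?case
    using d by simp
qed simp

lemma deriv_cofactor_diff: "deriv_cofactor f n k (g - h) = deriv_cofactor f n k g - deriv_cofactor f n k h"
  by (induction k) (simp_all add: pderiv_diff right_diff_distrib smult_diff_right)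

lemma deriv_cofactor_polys_below:
  assumes "h \<in> polys_below a" "degree f \<le> m"
  shows "deriv_cofactor f n k h \<in> polys_below (a + k * m)"
proof (induction k)
  case (Suc k)
  have "degree (pderiv f) \<le> m"
    using assms(2) degree_pderiv_le[of f] by linarith
  then have "pderiv f * deriv_cofactor f n k h \<in> polys_below (a + k * m + m)"
    by (intro polys_below_mult Suc)
  moreover have "f * pderiv (deriv_cofactor f n k h) \<in> polys_below (a + k * m + m)"
    by (intro polys_below_mult polys_below_pderiv Suc assms)
  ultimately have "deriv_cofactor f n (Suc k) h \<in> polys_below (a + k * m + m)"
    by (auto intro: polys_below_add polys_below_smult)
  moreover have "a + k * m + m = a + Suc k * m"
    by simp
  ultimately show ?case
    by metis
qed (use assms in simp)

lemma higher_pderiv_sum: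
  fixes u :: "'b \<Rightarrow> 'a::idom poly"
  shows "(pderiv ^^ k) (\<Sum>j\<in>S. u j) = (\<Sum>j\<in>S. (pderiv ^^ k) (u j))"
proof (induction k)
  case (Suc k)
  then show ?case
    by (simp add: pderiv_sum)
qed simp

lemma higher_pderiv_add:
  fixes u v :: "'a::idom poly"
  shows "(pderiv ^^ k) (u + v) = (pderiv ^^ k) u + (pderiv ^^ k) v"
  by (induction k) (auto simp: pderiv_add)

text \<open>
  Used with \<open>v = X ^ (j * q)\<close>, which is a constant for the derivation in characteristic \<open>q\<close>.
\<close>
lemma higher_pderiv_mult_const:
  fixes u v :: "'a::idom poly"
  assumes "pderiv v = 0"
  shows "(pderiv ^^ k) (u * v) = (pderiv ^^ k) u * v"
  by (induction k) (auto simp: pderiv_mult assms)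

section \<open>Zeros of high multiplicity in prime characteristic\<close>

lemma poly_higher_pderiv_linear_power_mult:
  "poly ((pderiv ^^ k) ([:- x, 1:] ^ k * u)) x = of_nat (fact k) * poly u (x::'a::idom)"
proof (induction k arbitrary: u)
  case (Suc k)
  have "pderiv ([:- x, 1:] ^ Suc k * u)
      = [:- x, 1:] ^ k * (smult (of_nat (Suc k)) u + [:- x, 1:] * pderiv u)"
    by (simp add: pderiv_mult pderiv_power_Suc pderiv_pCons algebra_simps del: power_Suc)
       (simp add: algebra_simps)
  then have "poly ((pderiv ^^ Suc k) ([:- x, 1:] ^ Suc k * u)) x
      = of_nat (fact k) * poly (smult (of_nat (Suc k)) u + [:- x, 1:] * pderiv u) x"
    using Suc by (simp add: funpow_swap1 del: power_Suc)
  then show ?case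
    by (simp add: algebra_simps)
qed simp

text \<open>
  Dividing out the known power of \<open>X - x\<close>, the next derivative at \<open>x\<close> is a factorial times the
  value of the quotient, and factorials below the characteristic are invertible. For more than
  \<open>CHAR('a)\<close> derivatives the claim fails: all derivatives of \<open>X ^ CHAR('a)\<close> vanish at 0.
\<close>
lemma linear_power_dvd_if_higher_pderivs_vanish:
  fixes u :: "'a::idom poly"
  assumes "l \<le> CHAR('a)" "\<And>k. k < l \<Longrightarrow> poly ((pderiv ^^ k) u) x = 0"
  shows "[:- x, 1:] ^ l dvd u"
  using assms
proof (induction l)
  case (Suc l)
  then obtain v where v: "u = [:- x, 1:] ^ l * v"
    by (auto elim: dvdE)
  have prime: "prime CHAR('a)"
    using Suc.prems(1) by (intro prime_CHAR_semidom) auto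
  have "of_nat (fact l) \<noteq> (0::'a)"
    using Suc.prems(1) prime by (simp add: of_nat_eq_0_iff_char_dvd prime_dvd_fact_iff)
  moreover have "of_nat (fact l) * poly v x = 0"
    using Suc.prems(2)[of l] by (simp add: v poly_higher_pderiv_linear_power_mult)
  ultimately have "[:- x, 1:] dvd v"
    by (simp add: poly_eq_0_iff_dvd)
  then show ?case
    unfolding v power_Suc2 by (intro mult_dvd_mono) auto
qed simp

lemma card_common_zeros_of_derivs_le:
  fixes u :: "'a::idom poly"
  assumes "u \<noteq> 0" "l \<le> CHAR('a)"
    and "\<And>x k. x \<in> Z \<Longrightarrow> k < l \<Longrightarrow> poly ((pderiv ^^ k) u) x = 0"
  shows "l * card Z \<le> degree u"
proof (cases "l = 0")
  case False
  have Z: "Z \<subseteq> {x. poly u x = 0}"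
    using assms(3)[of _ 0] False by auto
  have fin: "finite {x. poly u x = 0}"
    using assms(1) by (rule poly_roots_finite)
  have "l \<le> order x u" if "x \<in> Z" for x
    using linear_power_dvd_if_higher_pderivs_vanish[OF assms(2), of u x] assms(1,3) that
    by (auto simp: order_divides)
  then have "l * card Z \<le> (\<Sum>x\<in>Z. order x u)"
    using sum_bounded_below[of Z l "\<lambda>x. order x u"] by (simp add: mult.commute)
  also have "\<dots> \<le> (\<Sum>x | poly u x = 0. order x u)"
    using Z fin by (intro sum_mono2) auto
  also have "\<dots> \<le> degree u"
    using assms(1) by (rule sum_order_le_degree)
  finally show ?thesis .
qed simp

section \<open>The auxiliary polynomial of Stepanov\<close>

text \<open>
  A homogeneous linear system with more unknowns than equations has a non-trivial solution. Over a
  finite field this is the pigeonhole principle: the families \<open>(r, s)\<close> have \<open>2 * (A * J)\<close> free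
  coefficients, the combinations for \<open>k < l\<close> together have \<open>\<Sum>k<l. A + k * m + J\<close>, so two families
  share all combinations, and their difference is the solution. At a point \<open>x\<close> with \<open>x ^ q = x\<close> and
  \<open>f(x) ^ c = a\<close> the \<open>k\<close>-th combination takes the same value, up to the factor \<open>f(x) ^ (l - k)\<close>, as the
  \<open>k\<close>-th derivative of \<open>f ^ l * (\<Sum>j<J. (r j + s j * f ^ c) * X ^ (j * q))\<close>.
\<close>
lemma exists_small_polys_with_vanishing_combinations:
  fixes f :: "'a::{idom,finite} poly"
  assumes "degree f \<le> m" "(\<Sum>k<l. A + k * m + J) < 2 * (A * J)"
  obtains r s :: "nat \<Rightarrow> 'a poly"
  where "\<And>j. j < J \<Longrightarrow> r j \<in> polys_below A" "\<And>j. j < J \<Longrightarrow> s j \<in> polys_below A"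
    and "\<exists>j<J. r j \<noteq> 0 \<or> s j \<noteq> 0"
    and "\<And>k. k < l \<Longrightarrow>
      (\<Sum>j<J. (deriv_cofactor f l k (r j) + smult a (deriv_cofactor f (l + c) k (s j))) * monom 1 j) = 0"
proof -
  define D where "D = (PiE {..<J} (\<lambda>_. polys_below A :: 'a poly set))"
  define E where "E = (PiE {..<l} (\<lambda>k. polys_below (A + k * m + J) :: 'a poly set))"
  define comb where "comb = (\<lambda>(r, s) k.
    \<Sum>j<J. (deriv_cofactor f l k (r j) + smult a (deriv_cofactor f (l + c) k (s j))) * monom 1 j)"
  define \<Phi> where "\<Phi> = (\<lambda>rs. restrict (comb rs) {..<l})"
  have "CARD('a) > 1"
    using card_mono[of UNIV "{0, 1 :: 'a}"] by simp
  moreover have "card (D \<times> D) = CARD('a) ^ (2 * (A * J))"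
    by (simp add: D_def card_cartesian_product card_PiE card_polys_below mult_2 power_add power_mult)
  moreover have "card E = CARD('a) ^ (\<Sum>k<l. A + k * m + J)"
    by (simp add: E_def card_PiE card_polys_below power_sum)
  ultimately have less: "card E < card (D \<times> D)"
    using assms(2) by simp
  have "finite E"
    by (auto simp: E_def intro!: finite_PiE)
  have "\<Phi> ` (D \<times> D) \<subseteq> E"
  proof safe
    fix r s assume rs: "r \<in> D" "s \<in> D"
    have "comb (r, s) k \<in> polys_below (A + k * m + J)" for k
      unfolding comb_def prod.case
    proof (intro polys_below_sum)
      fix j assume "j \<in> {..<J}"
      then have "r j \<in> polys_below A" "s j \<in> polys_below A"
        using rs by (auto simp: D_def)
      then have "(deriv_cofactor f l k (r j) + smult a (deriv_cofactor f (l + c) k (s j))) * monom 1 j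
          \<in> polys_below (A + k * m + j)"
        by (intro polys_below_mult_monom polys_below_add polys_below_smult
            deriv_cofactor_polys_below assms(1))
      then show "(deriv_cofactor f l k (r j) + smult a (deriv_cofactor f (l + c) k (s j))) * monom 1 j
          \<in> polys_below (A + k * m + J)"
        using \<open>j \<in> {..<J}\<close> by (auto elim: polys_below_mono)
    qed
    then show "\<Phi> (r, s) \<in> E"
      by (auto simp: \<Phi>_def E_def)
  qed
  then have "card (\<Phi> ` (D \<times> D)) \<le> card E"
    using \<open>finite E\<close> by (rule card_mono[rotated])
  then have "\<not> inj_on \<Phi> (D \<times> D)"
    using less card_image by fastforce
  then obtain r1 s1 r2 s2 where rs: "r1 \<in> D" "s1 \<in> D" "r2 \<in> D" "s2 \<in> D"
    and neq: "(r1, s1) \<noteq> (r2, s2)" and eq: "\<Phi> (r1, s1) = \<Phi> (r2, s2)"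
    by (fastforce simp: inj_on_def)
  show ?thesis
  proof
    show "r1 j - r2 j \<in> polys_below A" "s1 j - s2 j \<in> polys_below A" if "j < J" for j
      using rs that by (auto simp: D_def intro!: polys_below_diff)
    show "\<exists>j<J. r1 j - r2 j \<noteq> 0 \<or> s1 j - s2 j \<noteq> 0"
    proof (rule ccontr)
      assume "\<not> ?thesis"
      then have "r1 j = r2 j" "s1 j = s2 j" if "j \<in> {..<J}" for j
        using that by auto
      then have "r1 = r2" "s1 = s2"
        using rs unfolding D_def by (blast intro: PiE_ext)+
      with neq show False by simp
    qed
    fix k assume "k < l"
    then have "comb (r1, s1) k - comb (r2, s2) k = 0"
      using fun_cong[OF eq, of k] by (simp add: \<Phi>_def)
    then have "0 = (\<Sum>j<J.
        (deriv_cofactor f l k (r1 j) + smult a (deriv_cofactor f (l + c) k (s1 j))) * monom 1 j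
      - (deriv_cofactor f l k (r2 j) + smult a (deriv_cofactor f (l + c) k (s2 j))) * monom 1 j)"
      by (simp only: comb_def prod.case sum_subtractf)
    also have "\<dots> = (\<Sum>j<J. (deriv_cofactor f l k (r1 j - r2 j)
        + smult a (deriv_cofactor f (l + c) k (s1 j - s2 j))) * monom 1 j)"
      by (intro sum.cong refl) (simp add: deriv_cofactor_diff smult_diff_right left_diff_distrib distrib_right)
    finally show "(\<Sum>j<J. (deriv_cofactor f l k (r1 j - r2 j)
        + smult a (deriv_cofactor f (l + c) k (s1 j - s2 j))) * monom 1 j) = 0"
      by (rule sym)
  qed
qed

text \<open>
  Write \<open>f = f(0) + X g\<close> and apply the Frobenius endomorphism.
\<close>
lemma monom_CHAR_dvd_power_minus_const:
  fixes f :: "'a::finite_field poly"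
  assumes "q = CHAR('a)"
  shows "monom 1 q dvd f ^ q - [:poly f 0 ^ q:]"
proof -
  obtain a g where f: "f = pCons a g" by (cases f)
  have "f = [:a:] + [:0, 1:] * g"
    by (simp add: f)
  then have "f ^ q = [:a:] ^ q + ([:0, 1:] * g) ^ q"
    using freshmans_dream[of q "[:a:]" "[:0, 1:] * g"] assms by simp
  also have "\<dots> = [:a ^ q:] + monom 1 q * g ^ q"
    by (simp add: power_mult_distrib x_as_monom monom_power poly_const_pow)
  finally show ?thesis
    by (simp add: f)
qed

text \<open>
  Modulo \<open>X ^ q\<close> the power \<open>f ^ q\<close> is the constant \<open>f(0) ^ q\<close>. Since
  \<open>f * (f ^ c)\<^sup>2 = f ^ q\<close>, the congruence \<open>r \<equiv> - s * f ^ c\<close>, when squared and multiplied by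
  \<open>f\<close>, becomes one between \<open>r\<^sup>2 * f\<close> and a constant multiple of \<open>s\<^sup>2\<close>. Both sides have degree below \<open>q\<close>,
  so they are equal; but the order of the zero \<open>b\<close> is odd on the left and even on the right.
\<close>
lemma no_small_relation_with_power:
  fixes f :: "'a::finite_field poly"
  assumes q: "q = CHAR('a)" "q = 2 * c + 1"
    and f0: "poly f 0 \<noteq> 0" and root: "odd (order b f)" and m: "degree f \<le> m" "2 * A + m \<le> q + 1"
    and rs: "r \<in> polys_below A" "s \<in> polys_below A"
    and dvd: "monom 1 q dvd r + s * f ^ c"
  shows "r = 0 \<and> s = 0"
proof -
  define C where "C = poly f 0 ^ q"
  have "C \<noteq> 0" using f0 by (simp add: C_def)
  have "f \<noteq> 0" using f0 by auto
  have "f ^ q = f * (f ^ c)\<^sup>2"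
    using q(2) by (simp add: power_mult power_add mult.commute)
  then have "r\<^sup>2 * f - smult C (s\<^sup>2) = (r + s * f ^ c) * (r - s * f ^ c) * f + s\<^sup>2 * (f ^ q - [:C:])"
    by (simp add: power2_eq_square algebra_simps)
  then have "monom 1 q dvd r\<^sup>2 * f - smult C (s\<^sup>2)"
    using dvd monom_CHAR_dvd_power_minus_const[OF q(1), of f] unfolding C_def
    by (metis dvd_add dvd_mult dvd_mult2)
  moreover have "r\<^sup>2 * f - smult C (s\<^sup>2) \<in> polys_below q"
  proof (cases "A = 0")
    case True
    then show ?thesis using rs by (simp add: polys_below_0)
  next
    case False
    have sq: "u\<^sup>2 \<in> polys_below (2 * A - 1)" if "u \<in> polys_below A" for u :: "'a poly"
    proof (cases "u = 0")
      case False
      then have "degree u < A"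
        using that degree_less_if_polys_below by blast
      then show ?thesis
        using degree_mult_le[of u u] by (intro polys_belowI) (simp add: power2_eq_square)
    qed simp
    have "f * r\<^sup>2 \<in> polys_below (2 * A - 1 + m)"
      by (intro polys_below_mult sq rs m)
    moreover have "smult C (s\<^sup>2) \<in> polys_below (2 * A - 1)"
      by (intro polys_below_smult sq rs)
    ultimately show ?thesis
      using m(2) False
      by (intro polys_below_diff) (auto simp: mult.commute elim: polys_below_mono)
  qed
  ultimately have "r\<^sup>2 * f - smult C (s\<^sup>2) = 0"
    by (metis degree_less_if_polys_below degree_monom_eq dvd_imp_degree_le linorder_not_less
        zero_neq_one)
  then have eq: "r\<^sup>2 * f = smult C (s\<^sup>2)" by simp
  show ?thesis
  proof (rule ccontr)
    assume "\<not> ?thesis"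
    then have "r \<noteq> 0" "s \<noteq> 0"
      using eq \<open>C \<noteq> 0\<close> \<open>f \<noteq> 0\<close> by auto
    then have "order b (r\<^sup>2 * f) = 2 * order b r + order b f"
      using \<open>f \<noteq> 0\<close> by (simp add: order_mult power2_eq_square)
    moreover have "order b (smult C (s\<^sup>2)) = 2 * order b s"
      using \<open>s \<noteq> 0\<close> \<open>C \<noteq> 0\<close> by (simp add: order_smult order_mult power2_eq_square)
    ultimately show False
      using eq root by (metis dvd_triv_left even_add)
  qed
qed

lemma monom_dvd_monom: "i \<le> j \<Longrightarrow> monom (1::'a::comm_semiring_1) i dvd monom 1 j"
  by (metis dvd_triv_left le_add_diff_inverse mult.right_neutral mult_monom)

text \<open>
  In the sum, the first index with a non-zero pair cannot be compensated by the later ones, which are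
  divisible by a higher power of \<open>X ^ q\<close>.
\<close>
lemma auxiliary_sum_nonzero:
  fixes f :: "'a::finite_field poly"
  assumes q: "q = CHAR('a)" "q = 2 * c + 1"
    and f0: "poly f 0 \<noteq> 0" and root: "odd (order b f)" and m: "degree f \<le> m" "2 * A + m \<le> q + 1"
    and r: "\<And>j. j < J \<Longrightarrow> r j \<in> polys_below A" and s: "\<And>j. j < J \<Longrightarrow> s j \<in> polys_below A"
    and nz: "\<exists>j<J. r j \<noteq> 0 \<or> s j \<noteq> 0"
  shows "(\<Sum>j<J. (r j + s j * f ^ c) * monom 1 (j * q)) \<noteq> 0"
proof
  assume zero: "(\<Sum>j<J. (r j + s j * f ^ c) * monom 1 (j * q)) = 0"
  define k where "k = (LEAST j. j < J \<and> (r j \<noteq> 0 \<or> s j \<noteq> 0))"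
  have k: "k < J" "r k \<noteq> 0 \<or> s k \<noteq> 0"
    using LeastI_ex[OF nz] by (auto simp: k_def)
  have below: "r j = 0 \<and> s j = 0" if "j < k" for j
    using not_less_Least[of j "\<lambda>j. j < J \<and> (r j \<noteq> 0 \<or> s j \<noteq> 0)"] that k(1) by (auto simp: k_def)
  let ?t = "\<lambda>j. (r j + s j * f ^ c) * monom 1 (j * q)"
  have "(\<Sum>j<J. ?t j) = ?t k + (\<Sum>j\<in>{..<J} - {k}. ?t j)"
    using k(1) by (intro sum.remove) auto
  moreover have "monom 1 (Suc k * q) dvd (\<Sum>j\<in>{..<J} - {k}. ?t j)"
  proof (rule dvd_sum)
    fix j assume "j \<in> {..<J} - {k}"
    show "monom 1 (Suc k * q) dvd ?t j"
    proof (cases "j < k")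
      case False
      then have "Suc k * q \<le> j * q"
        using \<open>j \<in> {..<J} - {k}\<close> by (intro mult_le_mono1) auto
      then show ?thesis by (intro dvd_mult monom_dvd_monom)
    qed (simp add: below)
  qed
  ultimately have "monom 1 (Suc k * q) dvd ?t k"
    using zero by (simp add: dvd_add_left_iff add_eq_0_iff)
  then have "monom 1 (k * q) * monom 1 q dvd monom 1 (k * q) * (r k + s k * f ^ c)"
    by (simp add: mult_monom ac_simps)
  then have "monom 1 q dvd r k + s k * f ^ c"
    by (subst (asm) dvd_mult_cancel_left) simp
  with no_small_relation_with_power[OF q f0 root m r[OF k(1)] s[OF k(1)]] k(2) show False
    by blast
qed

text \<open>
  Each solution of \<open>f(x) ^ c = a\<close> is a zero of multiplicity at least \<open>l\<close> of the auxiliary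
  polynomial, whose degree is bounded by the right-hand side.
\<close>
theorem stepanov_inequality:
  fixes f :: "'a::finite_field poly"
  assumes q: "q = CHAR('a)" "CARD('a) = CHAR('a)" "q = 2 * c + 1" "a \<noteq> 0"
    and f0: "poly f 0 \<noteq> 0" and root: "odd (order b f)" and m: "degree f \<le> m" "2 * A + m \<le> q + 1"
    and count: "(\<Sum>k<l. A + k * m + J) < 2 * (A * J)" and l: "l \<le> q"
  shows "l * card {x. poly f x ^ c = a} \<le> l * m + c * m + A + J * q"
proof -
  obtain r s :: "nat \<Rightarrow> 'a poly"
    where r: "\<And>j. j < J \<Longrightarrow> r j \<in> polys_below A" and s: "\<And>j. j < J \<Longrightarrow> s j \<in> polys_below A"
    and nz: "\<exists>j<J. r j \<noteq> 0 \<or> s j \<noteq> 0"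
    and van: "\<And>k. k < l \<Longrightarrow>
      (\<Sum>j<J. (deriv_cofactor f l k (r j) + smult a (deriv_cofactor f (l + c) k (s j))) * monom 1 j) = 0"
    by (rule exists_small_polys_with_vanishing_combinations[OF m(1) count,
          where a = a and c = c]) (rule that; assumption)
  define P where "P = f ^ l * (\<Sum>j<J. (r j + s j * f ^ c) * monom 1 (j * q))"
  have "f \<noteq> 0" using f0 by auto
  then have "P \<noteq> 0"
    using auxiliary_sum_nonzero[OF q(1,3) f0 root m r s nz] by (simp add: P_def)
  have P_eq: "P = (\<Sum>j<J. (f ^ l * r j + f ^ (l + c) * s j) * monom 1 (j * q))"
    by (simp add: P_def sum_distrib_left power_add algebra_simps)
  have "pderiv (monom (1::'a) (j * q)) = 0" for j
    by (simp add: pderiv_monom q(1))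
  note const = higher_pderiv_mult_const[OF this]
  have "poly ((pderiv ^^ k) P) x = 0" if x: "poly f x ^ c = a" and k: "k < l" for x k
  proof -
    have "(pderiv ^^ k) P = (\<Sum>j<J. (f ^ (l - k) * deriv_cofactor f l k (r j)
        + f ^ (l + c - k) * deriv_cofactor f (l + c) k (s j)) * monom 1 (j * q))"
      using k by (simp add: P_eq higher_pderiv_sum const higher_pderiv_add higher_pderiv_power_mult)
    moreover have "l + c - k = l - k + c"
      using k by simp
    \<comment> \<open>powers of elements of the field are fixed by the Frobenius map, so \<open>X ^ (j * q)\<close> acts as \<open>X ^ j\<close>\<close>
    moreover have frob: "x ^ (j * q) = x ^ j" for j
      using finite_field_power_card_eq_same[of "x ^ j"] q(1,2) by (simp add: power_mult)
    ultimately have "poly ((pderiv ^^ k) P) x = poly f x ^ (l - k) *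
      (\<Sum>j<J. (poly (deriv_cofactor f l k (r j)) x + a * poly (deriv_cofactor f (l + c) k (s j)) x) * x ^ j)"
      by (simp add: poly_sum poly_monom power_add frob x[symmetric] sum_distrib_left algebra_simps)
    also have "(\<Sum>j<J. (poly (deriv_cofactor f l k (r j)) x + a * poly (deriv_cofactor f (l + c) k (s j)) x) * x ^ j)
        = poly (\<Sum>j<J. (deriv_cofactor f l k (r j) + smult a (deriv_cofactor f (l + c) k (s j))) * monom 1 j) x"
      by (simp add: poly_sum poly_monom algebra_simps)
    finally show ?thesis
      using van[OF k] by simp
  qed
  then have "l * card {x. poly f x ^ c = a} \<le> degree P"
    using \<open>P \<noteq> 0\<close> l q(1) by (intro card_common_zeros_of_derivs_le) auto
  also have "P \<in> polys_below (A + c * m + (J * q) + l * m)"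
    unfolding P_def
  proof (rule polys_below_mult, rule polys_below_sum)
    show "degree (f ^ l) \<le> l * m"
      using degree_power_le[of f l] m(1) by (metis le_trans mult.commute mult_le_mono2)
    fix j assume "j \<in> {..<J}"
    have "degree (f ^ c) \<le> c * m"
      using degree_power_le[of f c] m(1) by (metis le_trans mult.commute mult_le_mono2)
    then have "f ^ c * s j \<in> polys_below (A + c * m)"
      using s \<open>j \<in> {..<J}\<close> by (intro polys_below_mult) auto
    moreover have "r j \<in> polys_below (A + c * m)"
      using \<open>j \<in> {..<J}\<close> by (intro polys_below_mono[OF r]) auto
    ultimately have "(r j + f ^ c * s j) * monom 1 (j * q) \<in> polys_below (A + c * m + j * q)"
      by (intro polys_below_mult_monom polys_below_add)
    then have "(r j + f ^ c * s j) * monom 1 (j * q) \<in> polys_below (A + c * m + J * q)"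
      using \<open>j \<in> {..<J}\<close> by (elim polys_below_mono) simp
    then show "(r j + s j * f ^ c) * monom 1 (j * q) \<in> polys_below (A + c * m + J * q)"
      by (simp add: mult.commute)
  qed
  then have "degree P < A + c * m + (J * q) + l * m"
    using \<open>P \<noteq> 0\<close> degree_less_if_polys_below by blast
  finally show ?thesis by simp
qed

section \<open>The Weil bound over a prime field\<close>

text \<open>
  The choice of parameters. \<open>A\<close> is as large as \<open>no_small_relation_with_power\<close> permits, nearly \<open>q / 2\<close>.
  The equations number about \<open>l * q / 2 + m * l\<^sup>2 / 2 + l\<^sup>2 / 2\<close> and the unknowns about \<open>J * q\<close>, so with
  \<open>l\<^sup>2 \<le> q\<close> it suffices that \<open>J\<close> exceeds \<open>l / 2\<close> by a little more than \<open>m / 2\<close>; the surplus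
  \<open>m + 2\<close> also absorbs the lower-order terms.
\<close>
lemma stepanov_parameters:
  fixes q m l A J :: nat
  assumes q: "q \<ge> 400" "8 * m \<le> q" "m \<ge> 1" and l: "l\<^sup>2 \<le> q"
    and A: "A = (q + 1 - m) div 2" and J: "J = (l + 1) div 2 + m + 2"
  shows "(\<Sum>k<l. A + k * m + J) < 2 * (A * J)"
proof -
  \<comment> \<open>the arithmetic progression is summed in a form without subtraction or division\<close>
  have gauss: "2 * (\<Sum>k<n. A + k * m + J) + m * n = 2 * n * (A + J) + m * n\<^sup>2" for n
    by (induction n) (auto simp: algebra_simps power2_eq_square)
  have Ar: "2 * real A \<ge> real q - real m" "2 * real A \<le> real q + 1 - real m"
    using q(1,2) by (auto simp: A)
  have Jr: "2 * real J \<ge> real l + 2 * (real m + 2)" "2 * real J \<le> real l + 1 + 2 * (real m + 2)"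
    by (auto simp: J)
  have "(20 * l)\<^sup>2 \<le> q\<^sup>2"
  proof -
    have "(20 * l)\<^sup>2 \<le> 400 * q" using l by (simp add: power_mult_distrib)
    also have "\<dots> \<le> q * q" using q by simp
    finally show ?thesis by (simp add: power2_eq_square)
  qed
  then have lq: "20 * real l \<le> real q"
    by (metis of_nat_le_iff of_nat_mult of_nat_numeral power2_nat_le_eq_le)
  have l2: "real l * real l \<le> real q"
    using l by (metis of_nat_le_iff of_nat_mult power2_eq_square)
  have m8: "8 * real m \<le> real q" "real m \<ge> 1"
    using q by linarith+
  have "real l * (2 * real J) \<le> real l * (real l + 1 + 2 * (real m + 2))"
    using Jr by (intro mult_left_mono) auto
  then have 1: "2 * (real l * real J) \<le> real q + 5 * real l + 2 * (real l * real m)"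
    using l2 by (simp add: algebra_simps)
  have "(real q - real m) * (2 * (real m + 2)) \<le> (2 * real A) * (2 * real J - real l)"
    using Ar Jr m8 by (intro mult_mono) auto
  then have 2: "2 * (real q * real m) + 4 * real q - 2 * (real m * real m) - 4 * real m
      \<le> 4 * (real A * real J) - 2 * (real l * real A)"
    by (simp add: algebra_simps)
  have 3: "8 * (real m * real m) \<le> real q * real m"
    using mult_right_mono[OF m8(1), of "real m"] by (simp add: algebra_simps)
  have 4: "20 * (real l * real m) \<le> real q * real m"
    using mult_right_mono[OF lq, of "real m"] by (simp add: algebra_simps)
  have 5: "real m * (real l * real l) \<le> real q * real m"
    using mult_left_mono[OF l2, of "real m"] by (simp add: algebra_simps)
  have "real q * real m \<ge> 0" by simp
  then have "2 * (real l * real A) + 2 * (real l * real J) + real m * (real l * real l)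
      < 4 * (real A * real J)"
    using 1 2 3 4 5 lq m8 q(1) by linarith
  then have "real (2 * l * (A + J) + m * l\<^sup>2) < real (4 * (A * J))"
    by (simp add: algebra_simps power2_eq_square)
  then show ?thesis
    using gauss[of l] by linarith
qed

text \<open>
  With \<open>l\<close> the integer part of \<open>sqrt q\<close>, dividing Stepanov's inequality by \<open>l\<close> gives the main term
  \<open>J * q / l \<approx> q / 2\<close>; the surplus of \<open>J\<close> contributes \<open>O(m * q / l) = O(m * sqrt q)\<close>.
\<close>
lemma card_power_residue_values_le:
  fixes f :: "'a::finite_field poly"
  assumes q: "q = CHAR('a)" "CARD('a) = CHAR('a)" "q = 2 * c + 1" "a \<noteq> 0"
    and f0: "poly f 0 \<noteq> 0" and root: "odd (order b f)" and m: "degree f \<le> m"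
    and large: "q \<ge> 400" "8 * m \<le> q" "m \<ge> 1"
  shows "real (card {x. poly f x ^ c = a}) \<le> real q / 2 + 11 * real m * sqrt (real q)"
proof -
  define l where "l = nat \<lfloor>sqrt (real q)\<rfloor>"
  define A where "A = (q + 1 - m) div 2"
  define J where "J = (l + 1) div 2 + m + 2"
  define N where "N = card {x. poly f x ^ c = a}"
  have l_le: "real l \<le> sqrt (real q)" and l_ge: "real l \<ge> sqrt (real q) - 1"
    unfolding l_def by (simp, linarith)
  have sq: "sqrt (real q) \<ge> 20"
    using large(1) by (intro real_le_rsqrt) simp
  have l2: "l\<^sup>2 \<le> q"
    using l_le by (metis of_nat_0_le_iff of_nat_le_iff of_nat_power real_sqrt_le_iff
        real_sqrt_pow2 power_mono)
  have "l \<le> q"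
    using l2 by (metis le_square le_trans power2_eq_square)
  have "2 * A + m \<le> q + 1"
    using large by (simp add: A_def)
  then have "l * N \<le> l * m + c * m + A + J * q"
    unfolding N_def
    by (intro stepanov_inequality[OF q f0 root m] \<open>l \<le> q\<close>
        stepanov_parameters[OF large l2 A_def J_def])
  then have "real l * real N \<le> real l * real m + real c * real m + real A + real J * real q"
    by (metis (mono_tags, lifting) of_nat_add of_nat_le_iff of_nat_mult)
  moreover have "real c * real m \<le> real q * real m / 2"
    using q(3) by (auto simp: field_simps)
  moreover have "real A \<le> real q * real m / 2"
  proof -
    have "2 * real A \<le> real q * 1"
      using large by (simp add: A_def)
    also have "\<dots> \<le> real q * real m"
      using large by (intro mult_left_mono) auto
    finally show ?thesis by simp
  qed
  moreover have "real J * real q \<le> real l * real q / 2 + 4 * (real q * real m)"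
  proof -
    have "2 * real J \<le> real l + 8 * real m"
      using large by (simp add: J_def)
    from mult_right_mono[OF this, of "real q"] show ?thesis
      by (simp add: algebra_simps)
  qed
  ultimately have "real l * real N \<le> real l * real m + real l * real q / 2 + 5 * (real q * real m)"
    by linarith
  also have "real q * real m \<le> real l * (2 * (real m * sqrt (real q)))"
  proof -
    have "sqrt (real q) \<le> 2 * real l"
      using l_ge sq by linarith
    from mult_right_mono[OF this, of "real m * sqrt (real q)"] show ?thesis
      by (simp add: algebra_simps flip: real_sqrt_mult)
  qed
  finally have "real l * real N \<le> real l * (real m + real q / 2 + 10 * (real m * sqrt (real q)))"
    by (simp add: algebra_simps)
  then have "real N \<le> real m + real q / 2 + 10 * (real m * sqrt (real q))"
    using l_ge sq by (simp add: mult_le_cancel_left)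
  moreover have "real m * 1 \<le> real m * sqrt (real q)"
    using large(1) by (intro mult_left_mono) auto
  ultimately show ?thesis
    unfolding N_def by linarith
qed

text \<open>
  The two counts cover all of the field except the zeros of \<open>f\<close>, so an upper bound close to
  \<open>q / 2\<close> for each is also a lower bound for the other. If \<open>q\<close> is small or \<open>m\<close> is comparable to \<open>q\<close>,
  the estimate is weaker than the trivial bound \<open>q\<close>. The condition \<open>CARD('a) = CHAR('a)\<close> says that
  the field is a prime field.
\<close>
theorem hasse_weil_bound_hyperelliptic:
  fixes f :: "'a::finite_field poly"
  assumes q: "q = CHAR('a)" "CARD('a) = CHAR('a)" "q = 2 * c + 1"
    and f0: "poly f 0 \<noteq> 0" and root: "odd (order b f)" and m: "degree f \<le> m"
  shows "\<bar>real (card {x. poly f x ^ c = 1}) - real (card {x. poly f x ^ c = -1})\<bar>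
    \<le> 24 * real m * sqrt (real q)"
proof -
  define N where "N = (\<lambda>a. card {x. poly f x ^ c = a})"
  have "f \<noteq> 0" using f0 by auto
  have "order b f > 0"
    using root by (cases "order b f") auto
  then have m1: "m \<ge> 1"
    using order_degree[OF \<open>f \<noteq> 0\<close>, of b] m by linarith
  have "prime q"
    using q(1) by simp
  then have "q > 2"
    using q(3) prime_ge_2_nat[of q] by (cases "q = 2") auto
  then have "c > 0" using q(3) by simp
  have one: "real m * 1 \<le> real m * sqrt (real q)"
    using \<open>q > 2\<close> by (intro mult_left_mono) auto
  have le_q: "N a \<le> q" for a
    using card_mono[of UNIV "{x. poly f x ^ c = a}"] q(1,2) by (simp add: N_def)
  consider "q < 400" | "8 * m > q" | "q \<ge> 400" "8 * m \<le> q"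
    by linarith
  then have "\<bar>real (N 1) - real (N (-1))\<bar> \<le> 24 * (real m * sqrt (real q))"
  proof cases
    case 1
    have "sqrt (real q) \<le> 20"
      using 1 by (intro real_le_lsqrt) auto
    then have "real q \<le> 20 * (1 * sqrt (real q))"
      using mult_right_mono[of "sqrt (real q)" 20 "sqrt (real q)"] by simp
    also have "\<dots> \<le> 20 * (real m * sqrt (real q))"
      using m1 by (intro mult_left_mono mult_right_mono) auto
    finally show ?thesis
      using le_q[of 1] le_q[of "-1"] one by linarith
  next
    case 2
    have "real q \<le> 8 * real m"
      using 2 by linarith
    then show ?thesis
      using le_q[of 1] le_q[of "-1"] one by linarith
  next
    case 3
    have up: "real (N a) \<le> real q / 2 + 11 * (real m * sqrt (real q))" if "a \<noteq> 0" for a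
      using card_power_residue_values_le[OF q that f0 root m 3 m1] by (simp add: N_def)
    have "UNIV = {x. poly f x = 0} \<union> {x. poly f x ^ c = 1} \<union> {x. poly f x ^ c = -1}"
    proof -
      have "poly f x = 0 \<or> poly f x ^ c = 1 \<or> poly f x ^ c = -1" for x
      proof -
        have "poly f x * (poly f x ^ c)\<^sup>2 = poly f x ^ (2 * c + 1)"
          by (simp add: power_mult[symmetric] mult.commute)
        also have "\<dots> = poly f x"
          using finite_field_power_card_eq_same[of "poly f x"] q by simp
        finally have "poly f x * (poly f x ^ c)\<^sup>2 = poly f x" .
        then have "poly f x = 0 \<or> (poly f x ^ c)\<^sup>2 = 1"
          by (metis mult.right_neutral mult_cancel_left)
        then show ?thesis
          by (auto simp: power2_eq_1_iff)
      qed
      then show ?thesis by blast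
    qed
    then have "q \<le> card {x. poly f x = 0} + N 1 + N (-1)"
      using q(1,2) card_Un_le[of "{x. poly f x = 0} \<union> {x. poly f x ^ c = 1}" "{x. poly f x ^ c = -1}"]
        card_Un_le[of "{x. poly f x = 0}" "{x. poly f x ^ c = 1}"] by (simp add: N_def)
    moreover have "card {x. poly f x = 0} \<le> m"
      using card_poly_roots_bound[OF \<open>f \<noteq> 0\<close>] m by linarith
    ultimately have "real q \<le> real m + real (N 1) + real (N (-1))"
      by linarith
    then show ?thesis
      using up[of 1] up[of "-1"] one by auto
  qed
  then show ?thesis
    by (simp add: N_def mult.assoc)
qed

section \<open>Sums of products of Legendre symbols\<close>

definition legendre_sums_bounded :: "nat \<Rightarrow> bool" where
  "legendre_sums_bounded p \<longleftrightarrow> (\<forall>S\<subseteq>{1..<p}. S \<noteq> {} \<longrightarrow>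
     \<bar>\<Sum>x<p. \<Prod>i\<in>S. real_of_int (Legendre (int x + int i) (int p))\<bar>
       \<le> 24 * real (card S) * sqrt (real p))"

lemma of_nat_bij_prime_field:
  assumes "CARD('a::finite_field) = CHAR('a)"
  shows "bij_betw (of_nat :: nat \<Rightarrow> 'a) {..<CHAR('a)} UNIV"
proof -
  have inj: "inj_on (of_nat :: nat \<Rightarrow> 'a) {..<CHAR('a)}"
    by (auto simp: inj_on_def of_nat_eq_iff_cong_CHAR cong_def)
  then have "card ((of_nat :: nat \<Rightarrow> 'a) ` {..<CHAR('a)}) = CARD('a)"
    using assms by (simp add: card_image)
  then show ?thesis
    using inj by (simp add: bij_betw_def card_eq_UNIV_imp_eq_UNIV)
qed

lemma Legendre_cases: "Legendre a p = 0 \<or> Legendre a p = 1 \<or> Legendre a p = -1"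
  by (auto simp: Legendre_def)

text \<open>
  Euler's criterion, read in a field of characteristic \<open>2 * c + 1\<close>.
\<close>
lemma of_int_Legendre:
  assumes "CHAR('a::field_prime_char) = 2 * c + 1"
  shows "of_int (Legendre a (int CHAR('a))) = (of_int a ^ c :: 'a)"
proof -
  have "prime CHAR('a)" by simp
  moreover from this have "CHAR('a) > 2"
    using assms prime_ge_2_nat[of "CHAR('a)"] by (cases "CHAR('a) = 2") auto
  ultimately have "[Legendre a (int CHAR('a)) = a ^ c] (mod int CHAR('a))"
    using euler_criterion[of "CHAR('a)" a] assms by simp
  then show ?thesis
    by (metis of_int_eq_iff_cong_CHAR of_int_power)
qed

text \<open>
  The product of the Legendre symbols is the \<open>c\<close>-th power of the value of
  \<open>f = \<Prod>i\<in>S. (X + i)\<close>, whose zeros are simple because the shifts are distinct modulo the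
  characteristic; as no shift is 0, also \<open>f(0) \<noteq> 0\<close>.
\<close>
lemma legendre_sums_bounded_prime_field:
  assumes card: "CARD('a::finite_field) = CHAR('a)" and odd: "CHAR('a) > 2"
  shows "legendre_sums_bounded CHAR('a)"
  unfolding legendre_sums_bounded_def
proof (intro allI impI)
  fix S :: "nat set" assume S: "S \<subseteq> {1..<CHAR('a)}" "S \<noteq> {}"
  define p where "p = CHAR('a)"
  have "prime p" by (simp add: p_def)
  then obtain c where c: "p = 2 * c + 1"
    using odd by (metis p_def oddE prime_odd_nat)
  have fin: "finite S" using S finite_subset by blast
  define f where "f = (\<Prod>i\<in>S. [:of_nat i, 1:] :: 'a poly)"
  define W where "W = (\<lambda>x. \<Prod>i\<in>S. Legendre (int x + int i) (int p))"
  have poly_f: "poly f y = (\<Prod>i\<in>S. of_nat i + y)" for y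
    by (simp add: f_def poly_prod)
  have f0: "poly f 0 \<noteq> 0"
  proof -
    have "of_nat i \<noteq> (0::'a)" if "i \<in> S" for i
      using that S by (fastforce simp: of_nat_eq_0_iff_char_dvd dest: dvd_imp_le)
    then show ?thesis
      using fin by (simp add: poly_f)
  qed
  obtain i0 where i0: "i0 \<in> S" using S by blast
  have "f = [:of_nat i0, 1:] * (\<Prod>i\<in>S - {i0}. [:of_nat i, 1:])"
    using i0 fin by (simp add: f_def prod.remove)
  moreover have "f \<noteq> 0" using f0 by auto
  moreover have "poly (\<Prod>i\<in>S - {i0}. [:of_nat i, 1:]) (- of_nat i0 :: 'a) \<noteq> 0"
  proof -
    have "of_nat i \<noteq> (of_nat i0 :: 'a)" if "i \<in> S - {i0}" for i
    proof -
      have "i < CHAR('a)" "i0 < CHAR('a)" "i \<noteq> i0"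
        using that S i0 by auto
      then show ?thesis
        by (simp add: of_nat_eq_iff_cong_CHAR cong_def)
    qed
    then show ?thesis
      using fin by (simp add: poly_prod)
  qed
  ultimately have "order (- of_nat i0) f = 1"
    by (metis (no_types, lifting) add.right_neutral minus_minus order_0I order_mult order_power_n_n power_one_right)
  then have root: "odd (order (- of_nat i0) f)" by simp
  have deg: "degree f \<le> card S"
    using degree_prod_sum_le[OF fin, of "\<lambda>i. [:of_nat i, 1:] :: 'a poly"] by (simp add: f_def)
  have W_poly: "of_int (W x) = poly f (of_nat x) ^ c" for x
    using of_int_Legendre[where 'a = 'a, OF c[unfolded p_def]]
    by (simp add: W_def poly_f p_def of_int_prod prod_power_distrib add.commute)
  have W_cases: "W x = 0 \<or> W x = 1 \<or> W x = -1" for x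
    unfolding W_def using fin
    by (induction S rule: finite_induct) (use Legendre_cases in \<open>fastforce+\<close>)
  \<comment> \<open>the values 0, 1 and -1 remain distinct in odd characteristic\<close>
  have small: "of_int k = (0::'a) \<longleftrightarrow> k = 0" if "\<bar>k\<bar> \<le> 2" for k
    using that odd zdvd_not_zless[of "\<bar>k\<bar>" "int CHAR('a)"]
    by (auto simp: of_int_eq_0_iff_char_dvd)
  have W_iff: "W x = e \<longleftrightarrow> poly f (of_nat x) ^ c = of_int e" if "e = 1 \<or> e = -1" for x e
  proof -
    have "\<bar>W x - e\<bar> \<le> 2"
      using W_cases[of x] that by auto
    from small[OF this] have "W x = e \<longleftrightarrow> of_int (W x) = (of_int e :: 'a)"
      by simp
    then show ?thesis
      by (simp only: W_poly)
  qed
  have card_eq: "card {x\<in>{..<p}. W x = e} = card {y. poly f y ^ c = of_int e}" if "e = 1 \<or> e = -1" for e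
  proof (rule bij_betw_same_card)
    show "bij_betw of_nat {x\<in>{..<p}. W x = e} {y. poly f y ^ c = of_int e}"
      using bij_betw_Collect[OF of_nat_bij_prime_field[OF card], folded p_def,
          of "\<lambda>y. poly f y ^ c = of_int e" "\<lambda>x. W x = e"] W_iff[OF that]
      by simp
  qed
  have "(\<Sum>x<p. W x) = (\<Sum>x<p. (if W x = 1 then 1 else 0) - (if W x = -1 then 1 else 0))"
  proof (intro sum.cong refl)
    fix x
    show "W x = (if W x = 1 then 1 else 0) - (if W x = -1 then 1 else 0)"
      using W_cases[of x] by auto
  qed
  also have "\<dots> = int (card {x\<in>{..<p}. W x = 1}) - int (card {x\<in>{..<p}. W x = -1})"
    by (simp add: sum_subtractf sum.If_cases Int_def conj_commute)
  finally have "(\<Sum>x<p. W x) = int (card {y. poly f y ^ c = 1}) - int (card {y. poly f y ^ c = -1})"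
    using card_eq[of 1] card_eq[of "-1"] by simp
  then have "real_of_int (\<Sum>x<p. W x)
      = real (card {y. poly f y ^ c = 1}) - real (card {y. poly f y ^ c = -1})"
    by simp
  then have "\<bar>real_of_int (\<Sum>x<p. W x)\<bar> \<le> 24 * real (card S) * sqrt (real p)"
    using hasse_weil_bound_hyperelliptic[OF p_def card c f0 root deg] by simp
  then show "\<bar>\<Sum>x<CHAR('a). \<Prod>i\<in>S. real_of_int (Legendre (int x + int i) (int CHAR('a)))\<bar>
       \<le> 24 * real (card S) * sqrt (real CHAR('a))"
    by (simp add: W_def p_def)
qed

text \<open>
  A prime for which the bound fails, if there is one. The bound at this single prime implies the
  bound at all odd primes; and since it is a constant, it can index a type. If the bound never fails,
  the value 3 merely provides some odd prime.
\<close>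
definition critical_prime :: nat where
  "critical_prime = (if \<exists>p. prime p \<and> p > 2 \<and> \<not> legendre_sums_bounded p
     then SOME p. prime p \<and> p > 2 \<and> \<not> legendre_sums_bounded p else 3)"

lemma critical_prime_counterexample:
  assumes "\<exists>p. prime p \<and> p > 2 \<and> \<not> legendre_sums_bounded p"
  shows "prime critical_prime \<and> critical_prime > 2 \<and> \<not> legendre_sums_bounded critical_prime"
proof -
  have "critical_prime = (SOME p. prime p \<and> p > 2 \<and> \<not> legendre_sums_bounded p)"
    unfolding critical_prime_def using assms by (rule if_P)
  then show ?thesis
    using someI_ex[OF assms] by simp
qed

lemma critical_prime: "prime critical_prime" "critical_prime > 2"
proof -
  have "prime critical_prime \<and> critical_prime > 2"
  proof (cases "\<exists>p. prime p \<and> p > 2 \<and> \<not> legendre_sums_bounded p")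
    case True
    from critical_prime_counterexample[OF this] show ?thesis by blast
  next
    case False
    then have "critical_prime = 3"
      unfolding critical_prime_def by (rule if_not_P)
    then show ?thesis
      unfolding \<open>critical_prime = 3\<close> by simp
  qed
  then show "prime critical_prime" "critical_prime > 2" by auto
qed

typedef critical_index = "{..<critical_prime}"
  using critical_prime(2) by (intro exI[of _ 0]) auto

lemma CARD_critical_index: "CARD(critical_index) = critical_prime"
  using type_definition.card[OF type_definition_critical_index] by simp

instance critical_index :: finite
proof
  show "finite (UNIV :: critical_index set)"
    using CARD_critical_index critical_prime(2) by (intro card_ge_0_finite) simp
qed

instance critical_index :: prime_card
  by standard (simp add: CARD_critical_index critical_prime)

text \<open>
  The field \<open>critical_index mod_ring\<close> proves the bound at the critical prime, so this prime is
  not a counterexample; hence there is none.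
\<close>
theorem weil_bound_Legendre:
  assumes "prime p" "p > 2" "S \<subseteq> {1..<p}" "S \<noteq> {}"
  shows "\<bar>\<Sum>x<p. \<Prod>i\<in>S. real_of_int (Legendre (int x + int i) (int p))\<bar>
    \<le> 24 * real (card S) * sqrt (real p)"
proof -
  have "legendre_sums_bounded critical_prime"
    using legendre_sums_bounded_prime_field[where 'a = "critical_index mod_ring"] critical_prime(2)
    by (simp add: CARD_critical_index)
  then have "\<not> (\<exists>p. prime p \<and> p > 2 \<and> \<not> legendre_sums_bounded p)"
    using critical_prime_counterexample by blast
  then have "legendre_sums_bounded p"
    using assms by blast
  then show ?thesis
    using assms unfolding legendre_sums_bounded_def by blast
qed

section \<open>Residues followed by a run without residues\<close>

text \<open>
  Expanding the product gives \<open>2 ^ K\<close> character sums with weight \<open>1 / 2 ^ K\<close> each: the one for the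
  empty set of factors is \<open>p\<close>, all others are small by Weil's bound.
\<close>
lemma sum_prod_Legendre_factors:
  fixes e :: "nat \<Rightarrow> real"
  assumes p: "prime p" "p > 2" "K < p" and e: "\<And>i. \<bar>e i\<bar> \<le> 1"
  shows "\<bar>(\<Sum>x<p. \<Prod>i=1..K. (1 + e i * Legendre (int x + int i) (int p)) / 2) - real p / 2 ^ K\<bar>
    \<le> 24 * real K * sqrt (real p)"
proof -
  define L where "L = (\<lambda>x i. real_of_int (Legendre (int x + int i) (int p)))"
  define W where "W = (\<lambda>S. \<Sum>x<p. \<Prod>i\<in>S. L x i)"
  let ?A = "{1..K}"
  define T where "T = (\<Sum>S\<in>Pow ?A - {{}}. (\<Prod>i\<in>S. e i) * W S)"
  have "(\<Sum>x<p. \<Prod>i=1..K. (1 + e i * L x i) / 2) * 2 ^ K = (\<Sum>x<p. \<Prod>i\<in>?A. e i * L x i + 1)"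
    by (simp add: prod_dividef sum_divide_distrib[symmetric] add.commute)
  also have "\<dots> = (\<Sum>x<p. \<Sum>S\<in>Pow ?A. (\<Prod>i\<in>S. e i) * (\<Prod>i\<in>S. L x i))"
    by (simp add: prod_add prod.distrib)
  also have "\<dots> = (\<Sum>S\<in>Pow ?A. (\<Prod>i\<in>S. e i) * W S)"
    by (subst sum.swap) (simp add: W_def sum_distrib_left)
  also have "\<dots> = real p + T"
    unfolding T_def by (subst sum.remove[of _ "{}"]) (auto simp: W_def)
  finally have eq: "(\<Sum>x<p. \<Prod>i=1..K. (1 + e i * L x i) / 2) - real p / 2 ^ K
      = T / 2 ^ K"
    by (simp add: eq_divide_eq left_diff_distrib)
  have "\<bar>T\<bar> \<le> (\<Sum>S\<in>Pow ?A - {{}}. 24 * real K * sqrt (real p))"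
    unfolding T_def
  proof (rule order.trans[OF sum_abs], rule sum_mono)
    fix S assume S: "S \<in> Pow ?A - {{}}"
    have "\<bar>\<Prod>i\<in>S. e i\<bar> \<le> 1"
      using e by (simp add: abs_prod prod_le_1)
    moreover have "\<bar>W S\<bar> \<le> 24 * real (card S) * sqrt (real p)"
      unfolding W_def L_def using S p by (intro weil_bound_Legendre) auto
    moreover have "24 * real (card S) * sqrt (real p) \<le> 24 * real K * sqrt (real p)"
      using S card_mono[of ?A S] by (intro mult_right_mono) auto
    ultimately have "\<bar>\<Prod>i\<in>S. e i\<bar> * \<bar>W S\<bar> \<le> 1 * (24 * real K * sqrt (real p))"
      by (intro mult_mono) auto
    then show "\<bar>(\<Prod>i\<in>S. e i) * W S\<bar> \<le> 24 * real K * sqrt (real p)"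
      by (simp add: abs_mult)
  qed
  also have "\<dots> \<le> 2 ^ K * (24 * real K * sqrt (real p))"
  proof -
    have "real (card (Pow ?A - {{}})) \<le> 2 ^ K"
      using card_mono[of "Pow ?A" "Pow ?A - {{}}"] by (simp add: card_Pow del: card_Diff_insert)
    then show ?thesis
      by (simp add: mult_right_mono)
  qed
  finally have "\<bar>T / 2 ^ K\<bar> \<le> 24 * real K * sqrt (real p)"
    by (simp add: abs_divide pos_divide_le_eq mult.commute)
  then show ?thesis
    unfolding eq[symmetric] L_def .
qed

text \<open>
  The pattern begins at \<open>x + 1\<close> in order that all shifts be non-zero modulo \<open>p\<close>; it is read
  cyclically.
\<close>
definition residue_then_gap :: "nat \<Rightarrow> nat \<Rightarrow> nat set" where
  "residue_then_gap p d = {x. x < p \<and> Legendre (int x + 1) (int p) = 1 \<and>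
     (\<forall>i\<in>{2..d + 1}. Legendre (int x + int i) (int p) \<noteq> 1)}"

text \<open>
  As long as none of \<open>x + 1, \<dots>, x + d + 1\<close> is divisible by \<open>p\<close>, the product of the factors
  \<open>(1 \<plusminus> Legendre) / 2\<close> is exactly the indicator function of the pattern. For the at most \<open>d + 1\<close>
  other \<open>x\<close> it lies between 0 and 1, whence an error of at most 1 for each.
\<close>
lemma card_residue_then_gap:
  assumes p: "prime p" "p > 2" "d + 1 < p"
  shows "\<bar>real (card (residue_then_gap p d)) - real p / 2 ^ (d + 1)\<bar> \<le> 25 * (real d + 1) * sqrt (real p)"
proof -
  define K where "K = d + 1"
  define e where "e = (\<lambda>i::nat. if i = 1 then 1 else -1 :: real)"
  define L where "L = (\<lambda>x i. real_of_int (Legendre (int x + int i) (int p)))"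
  define weight where "weight = (\<lambda>x. \<Prod>i=1..K. (1 + e i * L x i) / 2)"
  define bad where "bad = {x. x < p \<and> (\<exists>i\<in>{1..K}. L x i = 0)}"
  have L_cases: "L x i = 0 \<or> L x i = 1 \<or> L x i = -1" for x i
    using Legendre_cases[of "int x + int i" "int p"] by (auto simp: L_def)
  have weight_01: "0 \<le> weight x \<and> weight x \<le> 1" for x
  proof -
    have "0 \<le> (1 + e i * L x i) / 2 \<and> (1 + e i * L x i) / 2 \<le> 1" for i
      using L_cases[of x i] by (auto simp: e_def)
    then show ?thesis
      unfolding weight_def by (auto intro: prod_nonneg prod_le_1)
  qed
  have member: "x \<in> residue_then_gap p d \<longleftrightarrow> x < p \<and> (\<forall>i\<in>{1..K}. L x i = 1 \<longleftrightarrow> i = 1)" for x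
  proof -
    have "(\<forall>i\<in>{1..K}. L x i = 1 \<longleftrightarrow> i = 1) \<longleftrightarrow> L x 1 = 1 \<and> (\<forall>i\<in>{2..K}. L x i \<noteq> 1)"
      by (auto simp: K_def Suc_le_eq numeral_2_eq_2)
    then show ?thesis
      by (auto simp: residue_then_gap_def L_def K_def)
  qed
  have weight_eq: "weight x = of_bool (x \<in> residue_then_gap p d)" if "x < p" "x \<notin> bad" for x
  proof -
    have factor: "(1 + e i * L x i) / 2 = of_bool (L x i = 1 \<longleftrightarrow> i = 1)" if "i \<in> {1..K}" for i
    proof -
      have "L x i = 1 \<or> L x i = -1"
        using L_cases[of x i] \<open>x < p\<close> \<open>x \<notin> bad\<close> that by (auto simp: bad_def)
      then show ?thesis by (auto simp: e_def)
    qed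
    have "weight x = (\<Prod>i=1..K. of_bool (L x i = 1 \<longleftrightarrow> i = 1))"
      unfolding weight_def by (intro prod.cong refl factor)
    also have "\<dots> = of_bool (\<forall>i\<in>{1..K}. L x i = 1 \<longleftrightarrow> i = 1)"
      by (auto simp: prod_zero_iff intro!: prod.neutral)
    finally show ?thesis
      using \<open>x < p\<close> by (simp add: member)
  qed
  have "bad \<subseteq> (\<lambda>i. p - i) ` {1..K}"
  proof
    fix x assume "x \<in> bad"
    then obtain i where i: "x < p" "i \<in> {1..K}" "L x i = 0"
      by (auto simp: bad_def)
    have "[int (x + i) = 0] (mod int p)"
      using i(3) by (auto simp: L_def Legendre_def split: if_splits)
    then have "p dvd x + i"
      by (simp add: cong_0_iff flip: of_nat_add)
    then obtain k where k: "x + i = p * k" by (auto elim: dvdE)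
    then have "k = 1"
    proof -
      have "p * k < p * 2"
        using i p(3) unfolding k[symmetric] K_def by simp
      moreover have "k \<noteq> 0"
        using i(2) k by (cases "k = 0") auto
      ultimately show ?thesis by auto
    qed
    then show "x \<in> (\<lambda>i. p - i) ` {1..K}"
      using i k by (intro image_eqI[of _ _ i]) auto
  qed
  then have card_bad: "card bad \<le> K"
    using card_mono[of "(\<lambda>i. p - i) ` {1..K}" bad] card_image_le[of "{1..K}" "\<lambda>i. p - i"] by simp
  have "residue_then_gap p d \<subseteq> {..<p}"
    by (auto simp: residue_then_gap_def)
  then have "real (card (residue_then_gap p d)) = (\<Sum>x<p. of_bool (x \<in> residue_then_gap p d))"
    by (simp add: Int_absorb1 flip: Int_def)
  then have "\<bar>real (card (residue_then_gap p d)) - (\<Sum>x<p. weight x)\<bar>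
      = \<bar>\<Sum>x<p. of_bool (x \<in> residue_then_gap p d) - weight x\<bar>"
    by (simp add: sum_subtractf)
  also have "\<dots> \<le> (\<Sum>x<p. of_bool (x \<in> bad))"
  proof (rule order.trans[OF sum_abs], rule sum_mono)
    fix x assume "x \<in> {..<p}"
    then show "\<bar>of_bool (x \<in> residue_then_gap p d) - weight x\<bar> \<le> of_bool (x \<in> bad)"
      using weight_eq[of x] weight_01[of x] by (cases "x \<in> bad") auto
  qed
  also have "(\<Sum>x<p. of_bool (x \<in> bad)) = real (card bad)"
  proof -
    have "bad \<subseteq> {..<p}" by (auto simp: bad_def)
    then show ?thesis by (simp add: Int_absorb1 flip: Int_def)
  qed
  finally have "\<bar>real (card (residue_then_gap p d)) - (\<Sum>x<p. weight x)\<bar> \<le> real K"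
    using card_bad by linarith
  moreover have "\<bar>(\<Sum>x<p. weight x) - real p / 2 ^ K\<bar> \<le> 24 * (real K * sqrt (real p))"
  proof -
    have "K < p" and e1: "\<bar>e i\<bar> \<le> 1" for i
      using p(3) by (auto simp: K_def e_def)
    from sum_prod_Legendre_factors[OF p(1,2) this] show ?thesis
      by (simp only: weight_def L_def mult.assoc)
  qed
  moreover have "real K * 1 \<le> real K * sqrt (real p)"
    using p by (intro mult_left_mono) auto
  ultimately have "\<bar>real (card (residue_then_gap p d)) - real p / 2 ^ K\<bar> \<le> 25 * (real K * sqrt (real p))"
    by linarith
  then show ?thesis
    by (simp add: K_def algebra_simps)
qed

section \<open>The increasing enumeration of the quadratic residues\<close>

lemma mem_quad_residues_iff:
  assumes "prime p"
  shows "a \<in> quad_residues p \<longleftrightarrow> a < p \<and> Legendre (int a) (int p) = 1"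
proof -
  have "p > 0" using assms prime_gt_0_nat by blast
  have "\<not> [int a = 0] (mod int p)" if "1 \<le> a" "a < p"
    using that by (simp add: cong_0_iff nat_dvd_not_less)
  then show ?thesis
    using \<open>p > 0\<close>
    by (cases "a = 0"; cases "a < p") (auto simp: quad_residues_def Legendre_def)
qed

lemma finite_quad_residues [simp]: "finite (quad_residues p)"
  by (rule finite_subset[of _ "{..p}"]) (auto simp: quad_residues_def)

text \<open>
  Squaring is a bijection from \<open>{1..(p - 1) div 2}\<close> to the residues, because of each pair \<open>y\<close>,
  \<open>p - y\<close> of square roots exactly one lies in this range.
\<close>
lemma card_quad_residues:
  assumes p: "prime p" "p > 2"
  shows "card (quad_residues p) = (p - 1) div 2"
proof -
  define c where "c = (p - 1) div 2"
  have "odd p" using p prime_odd_nat by simp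
  then have pc: "p = 2 * c + 1"
    using p by (auto simp: c_def elim: oddE)
  have "bij_betw (\<lambda>y. y\<^sup>2 mod p) {1..c} (quad_residues p)"
    unfolding bij_betw_def
  proof
    show "inj_on (\<lambda>y. y\<^sup>2 mod p) {1..c}"
    proof (rule linorder_inj_onI')
      fix y z assume yz: "y \<in> {1..c}" "z \<in> {1..c}" "y < z"
      show "y\<^sup>2 mod p \<noteq> z\<^sup>2 mod p"
      proof
        assume "y\<^sup>2 mod p = z\<^sup>2 mod p"
        then have "p dvd z\<^sup>2 - y\<^sup>2"
          using yz by (metis mod_eq_dvd_iff_nat power_mono less_imp_le zero_le)
        also have "z\<^sup>2 - y\<^sup>2 = (z + y) * (z - y)"
          using less_imp_add_positive[OF yz(3)] by (auto simp: power2_eq_square algebra_simps)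
        finally have "p dvd z + y \<or> p dvd z - y"
          using p(1) prime_dvd_mult_iff by blast
        then show False
          using yz pc by (auto dest!: dvd_imp_le)
      qed
    qed
    show "(\<lambda>y. y\<^sup>2 mod p) ` {1..c} = quad_residues p"
    proof (intro equalityI subsetI)
      fix a assume "a \<in> (\<lambda>y. y\<^sup>2 mod p) ` {1..c}"
      then obtain y where y: "y \<in> {1..c}" "a = y\<^sup>2 mod p" by blast
      have "\<not> p dvd y\<^sup>2"
        using y pc p(1) by (auto simp: prime_dvd_power_iff dest: dvd_imp_le)
      then have "a \<noteq> 0"
        using y(2) by (simp add: mod_eq_0_iff_dvd)
      moreover have "a < p"
        using y(2) p by simp
      moreover have "QuadRes (int p) (int a)"
        unfolding QuadRes_def using y(2)
        by (intro exI[of _ "int y"]) (simp add: cong_def of_nat_mod)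
      ultimately show "a \<in> quad_residues p"
        by (auto simp: quad_residues_def)
    next
      fix a assume a: "a \<in> quad_residues p"
      then have a1: "1 \<le> a" "a < p" and "QuadRes (int p) (int a)"
        using p by (auto simp: quad_residues_def)
      then obtain y where y: "[y\<^sup>2 = int a] (mod int p)"
        by (auto simp: QuadRes_def)
      define z where "z = nat (y mod int p)"
      have z: "int z = y mod int p" "z < p"
        using p by (auto simp: z_def nat_less_iff)
      have sq: "[w\<^sup>2 = a] (mod p) \<Longrightarrow> w \<in> {1..c} \<Longrightarrow> a \<in> (\<lambda>y. y\<^sup>2 mod p) ` {1..c}" for w
        using a1 by (intro image_eqI[of _ _ w]) (auto simp: cong_def)
      have "[(int z)\<^sup>2 = int a] (mod int p)"
        using y unfolding z(1) by (simp add: cong_def power_mod)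
      then have z_sq: "[z\<^sup>2 = a] (mod p)"
        by (simp add: cong_int_iff flip: of_nat_power)
      have "z \<noteq> 0"
        using z_sq a1 by (cases "z = 0") (auto simp: cong_def)
      show "a \<in> (\<lambda>y. y\<^sup>2 mod p) ` {1..c}"
      proof (cases "z \<le> c")
        case True
        then show ?thesis using sq[OF z_sq] \<open>z \<noteq> 0\<close> by simp
      next
        case False
        have "int ((p - z)\<^sup>2) = (int p - int z)\<^sup>2"
          using z(2) by (simp add: of_nat_diff)
        also have "\<dots> = int (z\<^sup>2) + int p * (int p - 2 * int z)"
          by (simp add: power2_eq_square algebra_simps)
        finally have "[int ((p - z)\<^sup>2) = int (z\<^sup>2)] (mod int p)"
          by (simp add: cong_def)
        then have "[(p - z)\<^sup>2 = a] (mod p)"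
          using z_sq by (simp only: cong_int_iff) (rule cong_trans)
        moreover have "p - z \<in> {1..c}"
          using False z(2) pc by auto
        ultimately show ?thesis
          by (rule sq)
      qed
    qed
  qed
  then show ?thesis
    using bij_betw_same_card by (fastforce simp: c_def)
qed

lemma nth_qres_mem:
  assumes "prime p" "p > 2" "n < (p - 1) div 2"
  shows "nth_qres p n \<in> quad_residues p"
  using assms nth_mem[of n "sorted_list_of_set (quad_residues p)"]
  by (simp add: nth_qres_def card_quad_residues)

lemma nth_qres_less:
  assumes "prime p" "p > 2" "m < n" "n < (p - 1) div 2"
  shows "nth_qres p m < nth_qres p n"
  using assms strict_sorted_list_of_set[of "quad_residues p"]
  by (simp add: nth_qres_def sorted_wrt_nth_less card_quad_residues)

lemma quad_residue_is_nth_qres: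
  assumes "prime p" "p > 2" "a \<in> quad_residues p"
  obtains n where "n < (p - 1) div 2" "a = nth_qres p n"
proof -
  have "a \<in> set (sorted_list_of_set (quad_residues p))"
    using assms by simp
  then obtain n where "n < length (sorted_list_of_set (quad_residues p))"
      "sorted_list_of_set (quad_residues p) ! n = a"
    by (metis in_set_conv_nth)
  then show ?thesis
    using that[of n] assms by (simp add: nth_qres_def card_quad_residues)
qed

section \<open>Counting gaps by length and by parity\<close>

definition qres_gap :: "nat \<Rightarrow> nat \<Rightarrow> nat" where
  "qres_gap p n = nth_qres p (n + 1) - nth_qres p n"

definition num_gaps_exceeding :: "nat \<Rightarrow> nat \<Rightarrow> nat" where
  "num_gaps_exceeding p d = card {n. n < (p - 3) div 2 \<and> qres_gap p n > d}"

text \<open>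
  The start \<open>nth_qres p n\<close> of a long gap corresponds to \<open>x = nth_qres p n - 1\<close>. The cyclic count
  has at most one further element, coming from the largest residue.
\<close>
lemma num_gaps_exceeding_close_to_residue_then_gap:
  assumes p: "prime p" "p \<ge> 5"
  shows "\<bar>real (num_gaps_exceeding p d) - real (card (residue_then_gap p d))\<bar> \<le> 1"
proof -
  define h where "h = (p - 1) div 2"
  define G where "G = {n. n < (p - 3) div 2 \<and> qres_gap p n > d}"
  define pos where "pos = (\<lambda>n. nth_qres p n - 1)"
  have p2: "p > 2" using p by simp
  have hG: "n < (p - 3) div 2 \<longleftrightarrow> n + 1 < h" for n
    using p(2) by (auto simp: h_def)
  have mem: "nth_qres p n \<in> quad_residues p" if "n < h" for n
    using nth_qres_mem[OF p(1) p2] that by (simp add: h_def)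
  have pos1: "int (pos n) + 1 = int (nth_qres p n)" "nth_qres p n < p" if "n < h" for n
    using mem[OF that] p2 by (auto simp: pos_def quad_residues_def)
  have no_between: False if between: "n + 1 < h" "nth_qres p n < a" "a < nth_qres p (n + 1)"
      "a \<in> quad_residues p" for n a
  proof -
    obtain m where m: "m < h" "a = nth_qres p m"
      using quad_residue_is_nth_qres[OF p(1) p2 between(4)] by (auto simp: h_def)
    have less: "nth_qres p i < nth_qres p j" if "i < j" "j < h" for i j
      using nth_qres_less[OF p(1) p2] that by (simp add: h_def)
    consider "m \<le> n" | "m \<ge> n + 1" by linarith
    then show False
    proof cases
      case 1
      then show False using less[of m n] between(1,2) m by (cases "m = n") auto
    next
      case 2
      then show False using less[of "n + 1" m] between(3) m by (cases "m = n + 1") auto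
    qed
  qed
  have "inj_on pos {..<h}"
  proof (rule linorder_inj_onI')
    fix m n assume "m \<in> {..<h}" "n \<in> {..<h}" "m < n"
    then show "pos m \<noteq> pos n"
      using nth_qres_less[OF p(1) p2, of m n] pos1(1)[of m] pos1(1)[of n] by (auto simp: h_def)
  qed
  then have inj: "inj_on pos G"
    by (rule inj_on_subset) (auto simp: G_def hG)
  have sub1: "pos ` G \<subseteq> residue_then_gap p d"
  proof (rule image_subsetI)
    fix n assume "n \<in> G"
    then have n: "n + 1 < h" "nth_qres p n + d < nth_qres p (n + 1)"
      by (auto simp: G_def hG qres_gap_def)
    have "Legendre (int (pos n) + int i) (int p) \<noteq> 1" if "i \<in> {2..d + 1}" for i
    proof
      assume L: "Legendre (int (pos n) + int i) (int p) = 1"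
      have eq: "int (pos n) + int i = int (nth_qres p n + (i - 1))"
        using pos1(1)[of n] n(1) that by simp
      have less: "nth_qres p n + (i - 1) < nth_qres p (n + 1)" "nth_qres p (n + 1) < p"
        using that n pos1(2)[of "n + 1"] by auto
      then have mem: "nth_qres p n + (i - 1) \<in> quad_residues p"
        using L unfolding eq mem_quad_residues_iff[OF p(1)] by simp
      then show False
        using no_between[OF n(1) _ less(1) mem] that by simp
    qed
    moreover have "Legendre (int (pos n) + 1) (int p) = 1"
      using mem[of n] n(1) pos1(1)[of n] mem_quad_residues_iff[OF p(1)] by simp
    moreover have "pos n < p"
      using pos1(2)[of n] n(1) by (simp add: pos_def)
    ultimately show "pos n \<in> residue_then_gap p d"
      by (auto simp: residue_then_gap_def)
  qed
  have sub2: "residue_then_gap p d \<subseteq> insert (pos (h - 1)) (pos ` G)"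
  proof
    fix x assume x: "x \<in> residue_then_gap p d"
    then have L: "Legendre (int (x + 1)) (int p) = 1" "x < p"
      by (auto simp: residue_then_gap_def add.commute)
    have "x + 1 \<noteq> p"
      using L(1) by (auto simp: Legendre_def cong_def)
    then have "x + 1 \<in> quad_residues p"
      using L mem_quad_residues_iff[OF p(1)] by simp
    then obtain n where n: "n < h" "x + 1 = nth_qres p n"
      using quad_residue_is_nth_qres[OF p(1) p2] by (auto simp: h_def)
    then have x_pos: "x = pos n" by (simp add: pos_def flip: n(2))
    show "x \<in> insert (pos (h - 1)) (pos ` G)"
    proof (cases "n = h - 1")
      case False
      then have n1: "n + 1 < h" using n(1) by simp
      have "n \<in> G"
      proof (rule ccontr)
        assume "n \<notin> G"
        then have "qres_gap p n \<le> d"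
          using n1 by (auto simp: G_def hG)
        moreover have "nth_qres p n < nth_qres p (n + 1)"
          using nth_qres_less[OF p(1) p2, of n "n + 1"] n1 by (simp add: h_def)
        ultimately have i: "qres_gap p n + 1 \<in> {2..d + 1}"
            "int x + int (qres_gap p n + 1) = int (nth_qres p (n + 1))"
          using n(2) by (auto simp: qres_gap_def)
        have "Legendre (int (nth_qres p (n + 1))) (int p) = 1"
          using mem[OF n1] mem_quad_residues_iff[OF p(1)] by blast
        moreover have "Legendre (int x + int (qres_gap p n + 1)) (int p) \<noteq> 1"
          using x i(1) unfolding residue_then_gap_def by blast
        ultimately show False
          by (simp only: i(2))
      qed
      then show ?thesis using x_pos by simp
    qed (simp add: x_pos)
  qed
  have "finite G" by (simp add: G_def)
  have fin: "finite (residue_then_gap p d)"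
    by (simp add: residue_then_gap_def)
  have "card G \<le> card (residue_then_gap p d)"
    using card_mono[OF fin sub1] by (simp add: card_image[OF inj])
  moreover have "card (residue_then_gap p d) \<le> card G + 1"
    using card_mono[OF _ sub2] card_insert_le_m1 \<open>finite G\<close>
    by (simp add: card_insert_if card_image[OF inj] split: if_splits)
  ultimately show ?thesis
    by (simp add: num_gaps_exceeding_def G_def)
qed

lemma num_gaps_exceeding_asymptotic:
  assumes p: "prime p" "p \<ge> 5" "d + 1 < p"
  shows "\<bar>real (num_gaps_exceeding p d) - real p / 2 ^ (d + 1)\<bar> \<le> 26 * (real d + 1) * sqrt (real p)"
proof -
  have "1 * 1 \<le> (real d + 1) * sqrt (real p)"
    using p by (intro mult_mono) auto
  moreover have "\<bar>real (card (residue_then_gap p d)) - real p / 2 ^ (d + 1)\<bar>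
      \<le> 25 * ((real d + 1) * sqrt (real p))"
    using card_residue_then_gap[of p d] p by (simp add: algebra_simps)
  ultimately show ?thesis
    using num_gaps_exceeding_close_to_residue_then_gap[OF p(1,2), of d] by linarith
qed

text \<open>
  For \<open>g \<le> D\<close> the truncated sum is exact; otherwise both terms lie in \<open>{0, 1}\<close>.
\<close>
lemma alternating_sum_detects_odd:
  "\<bar>of_bool (odd g) - (\<Sum>d<D. (-1) ^ d * of_bool (d < g))\<bar> \<le> (of_bool (D < g) :: real)"
proof -
  have full: "(\<Sum>d<n. (-1) ^ d) = (of_bool (odd n) :: real)" for n :: nat
    by (induction n) auto
  have "(\<Sum>d<D. (-1) ^ d * of_bool (d < g)) = (\<Sum>d<min D g. (-1) ^ d :: real)"
    by (rule sum.mono_neutral_cong_right) auto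
  then show ?thesis
    by (auto simp: full min_def)
qed

lemma num_parity_1_eq:
  assumes "prime p" "p \<ge> 5"
  shows "num_parity p 1 = card {n. n < (p - 3) div 2 \<and> odd (qres_gap p n)}"
proof -
  have "n \<le> (p - 5) div 2 \<longleftrightarrow> n < (p - 3) div 2" for n
    using assms(2) prime_odd_nat[OF assms(1)] by linarith
  moreover have "qres_parity p n = 1 \<longleftrightarrow> odd (qres_gap p n)" if "n < (p - 3) div 2" for n
  proof -
    have "nth_qres p n < nth_qres p (n + 1)"
      using that assms by (intro nth_qres_less) auto
    then have "odd (qres_gap p n) \<longleftrightarrow> odd (nth_qres p n + nth_qres p (n + 1))"
      by (auto simp: qres_gap_def)
    moreover have "qres_parity p n = (nth_qres p n + nth_qres p (n + 1)) mod 2"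
      using that by (simp add: qres_parity_def)
    ultimately show ?thesis
      by (simp only: odd_iff_mod_2_eq_one)
  qed
  ultimately show ?thesis
    unfolding num_parity_def by (metis (no_types, lifting))
qed

lemma num_parity_sum:
  assumes "prime p" "p \<ge> 5"
  shows "num_parity p 0 + num_parity p 1 = (p - 3) div 2"
proof -
  define Z where "Z = (\<lambda>b. {n. n \<le> (p - 5) div 2 \<and> qres_parity p n = b})"
  have "qres_parity p n = 0 \<or> qres_parity p n = 1" for n
    unfolding qres_parity_def Let_def by linarith
  then have "{n. n \<le> (p - 5) div 2} = Z 0 \<union> Z 1"
    by (auto simp: Z_def)
  then have "card {n. n \<le> (p - 5) div 2} = card (Z 0 \<union> Z 1)"
    by (rule arg_cong)
  also have "\<dots> = card (Z 0) + card (Z 1)"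
    by (intro card_Un_disjoint) (auto simp: Z_def)
  also have "\<dots> = num_parity p 0 + num_parity p 1"
    unfolding num_parity_def Z_def ..
  finally have "card {n. n \<le> (p - 5) div 2} = num_parity p 0 + num_parity p 1" .
  moreover have "card {n. n \<le> (p - 5) div 2} = (p - 3) div 2"
    using assms(2) by (simp flip: atMost_def)
  ultimately show ?thesis by simp
qed

lemma num_parity_1_truncated:
  assumes "prime p" "p \<ge> 5"
  shows "\<bar>real (num_parity p 1) - (\<Sum>d<D. (-1) ^ d * real (num_gaps_exceeding p d))\<bar>
    \<le> real (num_gaps_exceeding p D)"
proof -
  define I where "I = {..<(p - 3) div 2}"
  have count: "real (card {n. n < (p - 3) div 2 \<and> Q n}) = (\<Sum>n\<in>I. of_bool (Q n))" for Q
    by (simp add: I_def Int_def)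
  have "(\<Sum>d<D. (-1) ^ d * real (num_gaps_exceeding p d))
      = (\<Sum>n\<in>I. \<Sum>d<D. (-1) ^ d * of_bool (d < qres_gap p n))"
    unfolding num_gaps_exceeding_def count sum_distrib_left by (rule sum.swap)
  then have "\<bar>real (num_parity p 1) - (\<Sum>d<D. (-1) ^ d * real (num_gaps_exceeding p d))\<bar>
      = \<bar>\<Sum>n\<in>I. of_bool (odd (qres_gap p n)) - (\<Sum>d<D. (-1) ^ d * of_bool (d < qres_gap p n))\<bar>"
    unfolding num_parity_1_eq[OF assms] count by (simp add: sum_subtractf)
  also have "\<dots> \<le> (\<Sum>n\<in>I. of_bool (D < qres_gap p n))"
    by (rule order.trans[OF sum_abs], rule sum_mono, rule alternating_sum_detects_odd)
  also have "\<dots> = real (num_gaps_exceeding p D)"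
    unfolding num_gaps_exceeding_def count by simp
  finally show ?thesis .
qed

text \<open>
  The geometric series \<open>p/2 - p/4 + \<dots>\<close> supplies \<open>p / 3\<close>. Each of the \<open>D + 1\<close> counts involved
  contributes an error \<open>O((D + 1) * sqrt p)\<close>; the terms coming from \<open>p / 2 ^ D \<le> 1\<close> are bounded
  by 1.
\<close>
lemma num_parity_1_bound:
  assumes p: "prime p" "p \<ge> 5" and D: "D + 1 < p" "p \<le> 2 ^ D"
  shows "\<bar>real (num_parity p 1) - real p / 3\<bar> \<le> 27 * (real D + 1)\<^sup>2 * sqrt (real p)"
proof -
  define s where "s = sqrt (real p)"
  have s1: "s \<ge> 1" using p by (simp add: s_def)
  have gap: "\<bar>real (num_gaps_exceeding p d) - real p / 2 ^ (d + 1)\<bar> \<le> 26 * (real D + 1) * s"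
    if "d \<le> D" for d
  proof -
    have "26 * (real d + 1) * s \<le> 26 * (real D + 1) * s"
      using that s1 by (intro mult_right_mono) auto
    moreover have "d + 1 < p"
      using D(1) that by simp
    ultimately show ?thesis
      unfolding s_def by (rule order.trans[OF num_gaps_exceeding_asymptotic[OF p], rotated])
  qed
  have geometric: "(\<Sum>d<n. (-1) ^ d * (real p / 2 ^ (d + 1))) = real p / 3 - real p / 3 * (-1/2) ^ n" for n
  proof (induction n)
    case (Suc n)
    have "(-1) ^ n * (real p / 2 ^ (n + 1)) = real p / 2 * (-1/2) ^ n"
      using power_minus[of "1 / 2 :: real" n] by (simp add: power_one_over field_simps)
    with Suc have "(\<Sum>d<Suc n. (-1) ^ d * (real p / 2 ^ (d + 1)))
        = real p / 3 - real p / 3 * (-1/2) ^ n + real p / 2 * (-1/2) ^ n"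
      by (simp only: sum.lessThan_Suc)
    then show ?case
      by simp
  qed simp
  have "\<bar>(\<Sum>d<D. (-1) ^ d * real (num_gaps_exceeding p d)) - (\<Sum>d<D. (-1) ^ d * (real p / 2 ^ (d + 1)))\<bar>
      = \<bar>\<Sum>d<D. (-1) ^ d * (real (num_gaps_exceeding p d) - real p / 2 ^ (d + 1))\<bar>"
    by (simp add: sum_subtractf right_diff_distrib)
  also have "\<dots> \<le> (\<Sum>d<D. 26 * (real D + 1) * s)"
    using gap by (intro order.trans[OF sum_abs] sum_mono) (auto simp: abs_mult)
  finally have main: "\<bar>(\<Sum>d<D. (-1) ^ d * real (num_gaps_exceeding p d))
      - (real p / 3 - real p / 3 * (-1/2) ^ D)\<bar> \<le> real D * (26 * (real D + 1) * s)"
    unfolding geometric by simp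
  have pD: "real p / 2 ^ D \<le> 1"
  proof -
    have "real p \<le> 2 ^ D"
      using D(2) by (metis of_nat_le_iff of_nat_numeral of_nat_power)
    then show ?thesis by simp
  qed
  have tail: "\<bar>real p / 3 * (-1/2) ^ D\<bar> \<le> 1 / 3"
    using pD by (simp add: abs_mult power_abs power_divide)
  have last: "real (num_gaps_exceeding p D) \<le> 1 / 2 + 26 * (real D + 1) * s"
  proof -
    have "n \<le> 1 / 2 + b" if "\<bar>n - y / 2\<bar> \<le> b" "y \<le> 1" for n y b :: real
      using that by linarith
    moreover have "\<bar>real (num_gaps_exceeding p D) - real p / 2 ^ D / 2\<bar> \<le> 26 * (real D + 1) * s"
      using gap[of D] by simp
    ultimately show ?thesis
      using pD by blast
  qed
  have triangle: "\<bar>n - x\<bar> \<le> b + 1"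
    if "\<bar>n - a\<bar> \<le> g" "\<bar>a - (x - u)\<bar> \<le> b'" "\<bar>u\<bar> \<le> 1 / 3" "g \<le> 1 / 2 + b''" "b = b' + b''"
    for n x a g u b b' b'' :: real
    using that by linarith
  have "\<bar>real (num_parity p 1) - real p / 3\<bar>
      \<le> (real D * (26 * (real D + 1) * s) + 26 * (real D + 1) * s) + 1"
    by (rule triangle[OF num_parity_1_truncated[OF p] main tail last refl])
  also have "\<dots> = 26 * ((real D + 1)\<^sup>2 * s) + 1"
    by (simp add: power2_eq_square algebra_simps)
  also have "\<dots> \<le> 27 * ((real D + 1)\<^sup>2 * s)"
  proof -
    have "1 * 1 \<le> (real D + 1)\<^sup>2 * s"
      using s1 by (intro mult_mono) (auto simp: one_le_power)
    moreover have "26 * X + 1 \<le> 27 * X" if "1 * 1 \<le> X" for X :: real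
      using that by linarith
    ultimately show ?thesis by blast
  qed
  finally show ?thesis
    by (simp add: s_def)
qed

lemma ex_binary_length:
  assumes "p \<ge> (5::nat)"
  obtains D where "D + 1 < p" "p \<le> 2 ^ D" "real D + 1 \<le> 4 * ln (real p)"
proof -
  define D where "D = (LEAST d. p \<le> 2 ^ d)"
  \<comment> \<open>this ensures \<open>D + 1 < p\<close>; for \<open>p = 5\<close> and \<open>D = 3\<close> it is sharp\<close>
  have "p \<le> 2 ^ (p - 2)"
    using assms
  proof (induction p rule: dec_induct)
    case (step n)
    then have "2 ^ (Suc n - 2) = 2 * (2::nat) ^ (n - 2)"
      by (simp flip: power_Suc add: Suc_diff_le)
    then show ?case using step by linarith
  qed simp
  then have D: "p \<le> 2 ^ D" "D \<le> p - 2"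
    unfolding D_def by (auto intro: LeastI Least_le)
  have "D \<noteq> 0"
    using D(1) assms by (cases "D = 0") auto
  then have "\<not> p \<le> 2 ^ (D - 1)"
    unfolding D_def by (intro not_less_Least) simp
  then have "2 ^ (D - 1) \<le> real p"
    by (metis less_imp_le linorder_not_le of_nat_less_iff of_nat_numeral of_nat_power)
  then have "ln ((2::real) ^ (D - 1)) \<le> ln (real p)"
    using assms by (intro ln_mono) auto
  then have "(real D - 1) * ln 2 \<le> ln (real p)"
    using \<open>D \<noteq> 0\<close> by (simp add: ln_realpow of_nat_diff)
  moreover have "(real D - 1) / 2 \<le> (real D - 1) * ln 2"
    using ln_le_minus_one[of "1 / 2"] \<open>D \<noteq> 0\<close>
    by (subst divide_inverse, intro mult_left_mono) (auto simp: ln_div)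
  moreover have "ln (real p) \<ge> 1"
  proof -
    have "exp 1 \<le> real p" using exp_le assms by linarith
    then show ?thesis using assms by (subst ln_ge_iff) auto
  qed
  ultimately have "(real D - 1) / 2 \<le> ln (real p)" "ln (real p) \<ge> 1"
    by linarith+
  then have "real D + 1 \<le> 4 * ln (real p)"
    by (simp add: field_simps)
  then show ?thesis
    using that[of D] D assms by simp
qed

theorem theorem2:
  shows "(\<exists>c::real. c > 0 \<and> (\<forall>p::nat. prime p \<and> p \<ge> 5 \<longrightarrow>
            \<bar>real (num_parity p 0) - real p / 6\<bar> \<le> c * (real p powr (1/2) * (ln (real p))\<^sup>2)))
       \<and> (\<exists>c::real. c > 0 \<and> (\<forall>p::nat. prime p \<and> p \<ge> 5 \<longrightarrow>
            \<bar>real (num_parity p 1) - real p / 3\<bar> \<le> c * (real p powr (1/2) * (ln (real p))\<^sup>2)))"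
proof -
  \<comment> \<open>\<open>432 = 27 * 4\<^sup>2\<close>, from \<open>D + 1 \<le> 4 * ln p\<close>\<close>
  have N1: "\<bar>real (num_parity p 1) - real p / 3\<bar> \<le> 432 * (real p powr (1/2) * (ln (real p))\<^sup>2)"
    and one: "1 \<le> 16 * (real p powr (1/2) * (ln (real p))\<^sup>2)"
    if p: "prime p" "p \<ge> 5" for p
  proof -
    obtain D where D: "D + 1 < p" "p \<le> 2 ^ D" "real D + 1 \<le> 4 * ln (real p)"
      using ex_binary_length[OF p(2)] .
    have sq: "(real D + 1)\<^sup>2 \<le> 16 * (ln (real p))\<^sup>2"
      using power_mono[OF D(3), of 2] by (simp add: power_mult_distrib)
    then have le: "(real D + 1)\<^sup>2 * sqrt (real p) \<le> 16 * (ln (real p))\<^sup>2 * sqrt (real p)"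
      by (rule mult_right_mono) simp
    then show "\<bar>real (num_parity p 1) - real p / 3\<bar> \<le> 432 * (real p powr (1/2) * (ln (real p))\<^sup>2)"
      using num_parity_1_bound[OF p D(1,2)] by (simp add: powr_half_sqrt mult_ac)
    have "1 * 1 \<le> (real D + 1)\<^sup>2 * sqrt (real p)"
      using p by (intro mult_mono) (auto simp: one_le_power)
    with le show "1 \<le> 16 * (real p powr (1/2) * (ln (real p))\<^sup>2)"
      by (simp add: powr_half_sqrt mult_ac)
  qed
  \<comment> \<open>\<open>3 / 2\<close> is the defect of \<open>(p - 3) / 2\<close> against \<open>p / 2\<close>; by the second fact it
     adds at most 24 to the constant\<close>
  have N0: "\<bar>real (num_parity p 0) - real p / 6\<bar> \<le> 456 * (real p powr (1/2) * (ln (real p))\<^sup>2)"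
    if p: "prime p" "p \<ge> 5" for p
  proof -
    have "odd p" using p prime_odd_nat by auto
    then have "2 * (num_parity p 0 + num_parity p 1) + 3 = p"
      using num_parity_sum[OF p] p(2) by (auto elim!: oddE)
    then have "real (2 * (num_parity p 0 + num_parity p 1) + 3) = real p"
      by simp
    then have "real (num_parity p 0) = real p / 2 - 3 / 2 - real (num_parity p 1)"
      by simp
    then show ?thesis
      using N1[OF p] one[OF p] by linarith
  qed
  show ?thesis
    using N0 N1 by (intro conjI exI[of _ 456] exI[of _ 432]) auto
qed

end
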